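(* Let $(M,\mathcal F)$ be a compact minimal lamination by hyperbolic surfaces, with laminated unit tangent bundle $\hat M$. If $\mathcal M\subset\hat M$ is a compact minimal set for the action of $B$ on $\hat M$ and, for every $x\in M$, the intersection $\mathcal M\cap T^1_x\mathcal F$ has more than one point, then $\mathcal M=\hat M$.
   Context: A compact lamination by hyperbolic surfaces $(M,\mathcal F)$ is a compact metrizable space $M$ with a family $\{(U_\alpha,\varphi_\alpha)\}$ such that $\{U_\alpha\}$ is an open covering of $M$; $\varphi_\alpha:U_\alpha\to D_\alpha\times T_\alpha$ is a homeomorphism, with $D_\alpha$ a bounded open disk in the Poincaré upper half plane $\mathbb H$ and $T_\alpha$ a topological space; and for $(y,t)\in\varphi_\beta(U_\alpha\cap U_\beta)$, $\varphi_\alpha\circ\varphi_\beta^{-1}(y,t)=(g_{\alpha\beta}(t)y,h_{\alpha\beta}(t))$ with $g_{\alpha\beta}(t)\in PSL(2,\mathbb R)$. (Then $h_{\alpha\beta}$ is a homeomorphism between open subsets of $T_\beta$ and $T_\alpha$, and $g_{\alpha\beta}$ is continuous in $t$.) The plaques $\varphi_\alpha^{-1}(D_\alpha\times\{t\})$ glue together to form maximal connected hyperbolic surfaces called leaves; $\mathcal F$ is the partition of $M$ into leaves. The lamination is minimal if all leaves are dense in $M$. The laminated unit tangent bundle is $\hat M=\bigcup_{x\in M}T^1_x\mathcal F$, where $T^1_x\mathcal F$ is the set of unit vectors at $x$ tangent to the leaf through $x$. It is topologized by the charts $\psi_\alpha$, with values in $T^1D_\alpha\times T_\alpha$, given by the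 leafwise differentials of $\varphi_\alpha$. Identify $T^1\mathbb H$ with $PSL(2,\mathbb R)$ as usual ($g\leftrightarrow g_*w_0$, $w_0$ the upward unit vector at $i$). Then the transition maps are $(g,t)\mapsto(g_{\alpha\beta}(t)g,h_{\alpha\beta}(t))$, so right multiplication in the charts defines a continuous right action of $PSL(2,\mathbb R)$ on $\hat M$, whose orbits are the unit tangent bundles $T^1L$ of the leaves $L$. The affine group is the subgroup $B=\left\{\begin{pmatrix}a&b\\0&a^{-1}\end{pmatrix}: a>0,\ b\in\mathbb R\right\}$ of $PSL(2,\mathbb R)$, acting on $\hat M$ by restriction. A minimal set for the $B$-action is a nonempty closed $B$-invariant subset containing no proper nonempty closed $B$-invariant subset. *)

theory Defs
  imports "HOL-Analysis.Analysis"
begin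

definition psl_rel :: "real^2^2 \<Rightarrow> real^2^2 \<Rightarrow> bool" where
  "psl_rel A B \<longleftrightarrow> det A = 1 \<and> det B = 1 \<and> (A = B \<or> A = - B)"

lemma part_equivp_psl_rel: "part_equivp psl_rel"
  by (rule part_equivpI) (auto simp: psl_rel_def symp_def transp_def intro!: exI[of _ "mat 1"])

quotient_type psl2r = "real^2^2" / partial: psl_rel
  by (rule part_equivp_psl_rel)

lemma matrix_mult_uminus_left: "(- A) ** B = - (A ** B)" for A B :: "real^2^2"
  by (simp add: matrix_matrix_mult_def vec_eq_iff sum_negf)

lemma matrix_mult_uminus_right: "A ** (- B) = - (A ** B)" for A B :: "real^2^2"
  by (simp add: matrix_matrix_mult_def vec_eq_iff sum_negf)

instantiation psl2r :: monoid_mult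
begin

lift_definition one_psl2r :: psl2r is "mat 1"
  by (simp add: psl_rel_def)

lift_definition times_psl2r :: "psl2r \<Rightarrow> psl2r \<Rightarrow> psl2r" is "(**)"
  by (auto simp: psl_rel_def det_mul matrix_mult_uminus_left matrix_mult_uminus_right)

instance
  by standard (transfer; simp add: psl_rel_def det_mul matrix_mul_assoc)+

end

lift_definition moebius :: "psl2r \<Rightarrow> complex \<Rightarrow> complex" is
  "\<lambda>A z. (of_real (A$1$1) * z + of_real (A$1$2)) / (of_real (A$2$1) * z + of_real (A$2$2))"
proof -
  fix A B :: "real^2^2"
  assume "psl_rel A B"
  then consider "A = B" | "A = - B" by (auto simp: psl_rel_def)
  then show "(\<lambda>z. (complex_of_real (A$1$1) * z + of_real (A$1$2)) / (of_real (A$2$1) * z + of_real (A$2$2)))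
           = (\<lambda>z. (of_real (B$1$1) * z + of_real (B$1$2)) / (of_real (B$2$1) * z + of_real (B$2$2)))"
  proof cases
    case 2
    have "(- a * z + - b) / (- c * z + - d) = (a * z + b) / (c * z + d)" for a b c d z :: complex
    proof -
      have "- a * z + - b = - (a * z + b)" "- c * z + - d = - (c * z + d)" by simp_all
      then show ?thesis by (simp only: minus_divide_divide)
    qed
    then show ?thesis by (auto simp: 2)
  qed simp
qed

definition affine_subgroup :: "psl2r set" where
  "affine_subgroup = {abs_psl2r (vector [vector [a, b], vector [0, inverse a]]) | a b :: real. a > 0}"

definition upper_half_plane :: "complex set" where
  "upper_half_plane = {z. Im z > 0}"

definition hyp_dist :: "complex \<Rightarrow> complex \<Rightarrow> real" where
  "hyp_dist z w = arcosh (1 + (cmod (z - w))\<^sup>2 / (2 * Im z * Im w))"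

definition hyp_disk :: "complex set \<Rightarrow> bool" where
  "hyp_disk D \<longleftrightarrow>
     (\<exists>c\<in>upper_half_plane. \<exists>r>0. D = {z \<in> upper_half_plane. hyp_dist c z < r})"

text \<open>
  Tangent vectors are pairs of a base point and a complex number; the hyperbolic norm of
  \<open>(z, w)\<close> is \<open>cmod w / Im z\<close>.
\<close>

definition unit_tangent_over :: "complex set \<Rightarrow> (complex \<times> complex) set" where
  "unit_tangent_over D = {(z, w). z \<in> D \<and> z \<in> upper_half_plane \<and> cmod w / Im z = 1}"

definition pushforward :: "psl2r \<Rightarrow> complex \<times> complex \<Rightarrow> complex \<times> complex" where
  "pushforward g p = (moebius g (fst p), deriv (moebius g) (fst p) * snd p)"

text \<open>The usual bijection from PSL(2,R) onto the unit tangent bundle of the upper half plane;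
  the base vector is the upward unit vector at \<open>\<i>\<close>.\<close>

definition psl_frame :: "psl2r \<Rightarrow> complex \<times> complex" where
  "psl_frame g = pushforward g (\<i>, \<i>)"

record ('m, 'i, 't) lamination =
  lspace :: "'m topology"
  charts :: "'i set"
  chart_dom :: "'i \<Rightarrow> 'm set"
  chart_disk :: "'i \<Rightarrow> complex set"
  chart_transversal :: "'i \<Rightarrow> 't topology"
  chart_map :: "'i \<Rightarrow> 'm \<Rightarrow> complex \<times> 't"

definition compact_hyperbolic_lamination :: "('m, 'i, 't) lamination \<Rightarrow> bool" where
  "compact_hyperbolic_lamination L \<longleftrightarrow>
     compact_space (lspace L) \<and> metrizable_space (lspace L) \<and>
     (\<forall>i\<in>charts L. openin (lspace L) (chart_dom L i)) \<and>
     topspace (lspace L) = (\<Union>i\<in>charts L. chart_dom L i) \<and>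
     (\<forall>i\<in>charts L. hyp_disk (chart_disk L i) \<and>
        homeomorphic_map (subtopology (lspace L) (chart_dom L i))
          (prod_topology (top_of_set (chart_disk L i)) (chart_transversal L i))
          (chart_map L i)) \<and>
     (\<forall>i\<in>charts L. \<forall>j\<in>charts L. \<exists>(g :: 't \<Rightarrow> psl2r) (h :: 't \<Rightarrow> 't).
        \<forall>(y, t) \<in> chart_map L j ` (chart_dom L i \<inter> chart_dom L j).
          chart_map L i (inv_into (chart_dom L j) (chart_map L j) (y, t)) = (moebius (g t) y, h t))"

definition same_plaque :: "('m, 'i, 't) lamination \<Rightarrow> 'm \<Rightarrow> 'm \<Rightarrow> bool" where
  "same_plaque L x y \<longleftrightarrow>
     (\<exists>i\<in>charts L. x \<in> chart_dom L i \<and> y \<in> chart_dom L i \<and>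
        snd (chart_map L i x) = snd (chart_map L i y))"

text \<open>Plaques are connected, so the leaf of \<open>x\<close> consists of the points that can be reached from
  \<open>x\<close> by a finite chain of plaques.\<close>

definition leaf :: "('m, 'i, 't) lamination \<Rightarrow> 'm \<Rightarrow> 'm set" where
  "leaf L x = {y. (same_plaque L)\<^sup>*\<^sup>* x y}"

definition minimal_lamination :: "('m, 'i, 't) lamination \<Rightarrow> bool" where
  "minimal_lamination L \<longleftrightarrow>
     (\<forall>x\<in>topspace (lspace L). lspace L closure_of leaf L x = topspace (lspace L))"

text \<open>
  A vector tangent to the leaf through \<open>x\<close> is encoded by its coordinates \<open>v i\<close> in all charts
  \<open>i\<close> around \<open>x\<close> (and \<open>0\<close> for the other indices). The coordinates are related by the
  differentials of the leafwise coordinate changes; these are holomorphic, so the differential is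
  multiplication by the complex derivative.
\<close>

definition leafwise_change ::
    "('m, 'i, 't) lamination \<Rightarrow> 'i \<Rightarrow> 'i \<Rightarrow> 't \<Rightarrow> complex \<Rightarrow> complex" where
  "leafwise_change L i j t y =
     fst (chart_map L i (inv_into (chart_dom L j) (chart_map L j) (y, t)))"

definition unit_tangent :: "('m, 'i, 't) lamination \<Rightarrow> 'm \<Rightarrow> ('i \<Rightarrow> complex) set" where
  "unit_tangent L x = {v.
     (\<forall>i. \<not> (i \<in> charts L \<and> x \<in> chart_dom L i) \<longrightarrow> v i = 0) \<and>
     (\<forall>i\<in>charts L. x \<in> chart_dom L i \<longrightarrow>
        (fst (chart_map L i x), v i) \<in> unit_tangent_over (chart_disk L i)) \<and>
     (\<forall>i\<in>charts L. \<forall>j\<in>charts L. x \<in> chart_dom L i \<inter> chart_dom L j \<longrightarrow>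
        v i = deriv (leafwise_change L i j (snd (chart_map L j x))) (fst (chart_map L j x)) * v j)}"

definition unit_tangent_bundle :: "('m, 'i, 't) lamination \<Rightarrow> ('m \<times> ('i \<Rightarrow> complex)) set" where
  "unit_tangent_bundle L = Sigma (topspace (lspace L)) (unit_tangent L)"

definition tangent_chart ::
    "('m, 'i, 't) lamination \<Rightarrow> 'i \<Rightarrow> 'm \<times> ('i \<Rightarrow> complex) \<Rightarrow> (complex \<times> complex) \<times> 't" where
  "tangent_chart L i \<xi> =
     ((fst (chart_map L i (fst \<xi>)), snd \<xi> i), snd (chart_map L i (fst \<xi>)))"

text \<open>The topology for which the sets \<open>{\<xi> \<in> unit_tangent_bundle L. fst \<xi> \<in> chart_dom L i}\<close>
  are open and the maps \<open>tangent_chart L i\<close> on them are homeomorphisms.\<close>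

definition tangent_topology ::
    "('m, 'i, 't) lamination \<Rightarrow> ('m \<times> ('i \<Rightarrow> complex)) topology" where
  "tangent_topology L = topology_generated_by
     {{\<xi> \<in> unit_tangent_bundle L. fst \<xi> \<in> chart_dom L i \<and> tangent_chart L i \<xi> \<in> W} | i W.
        i \<in> charts L \<and>
        openin (prod_topology (top_of_set (unit_tangent_over (chart_disk L i)))
                 (chart_transversal L i)) W}"

definition chart_right_mult ::
    "('m, 'i, 't) lamination \<Rightarrow> 'm \<times> ('i \<Rightarrow> complex) \<Rightarrow> psl2r \<Rightarrow> 'm \<times> ('i \<Rightarrow> complex) \<Rightarrow> bool" where
  "chart_right_mult L \<xi> g \<eta> \<longleftrightarrow>
     \<xi> \<in> unit_tangent_bundle L \<and> \<eta> \<in> unit_tangent_bundle L \<and>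
     (\<exists>i\<in>charts L. fst \<xi> \<in> chart_dom L i \<and> fst \<eta> \<in> chart_dom L i \<and>
        (\<exists>k t. tangent_chart L i \<xi> = (psl_frame k, t) \<and> tangent_chart L i \<eta> = (psl_frame (k * g), t)))"

text \<open>
  The graph of the action: \<open>right_action L \<xi> g \<eta>\<close> means \<open>\<xi> \<cdot> g = \<eta>\<close>. A single chart determines
  \<open>\<xi> \<cdot> g\<close> only when the result still lies over the same plaque. Since the space is compact, this is
  the case for all \<open>\<xi>\<close> and all \<open>g\<close> in some neighbourhood of \<open>1\<close>; these generate the connected
  group PSL(2,R), and the action of a product is the composition of the actions of the factors.
\<close>

inductive right_action ::
    "('m, 'i, 't) lamination \<Rightarrow> 'm \<times> ('i \<Rightarrow> complex) \<Rightarrow> psl2r \<Rightarrow> 'm \<times> ('i \<Rightarrow> complex) \<Rightarrow> bool"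
  for L where
  one: "\<xi> \<in> unit_tangent_bundle L \<Longrightarrow> right_action L \<xi> 1 \<xi>"
| mult: "right_action L \<xi> g \<eta> \<Longrightarrow> chart_right_mult L \<eta> h \<zeta> \<Longrightarrow> right_action L \<xi> (g * h) \<zeta>"

definition affine_invariant ::
    "('m, 'i, 't) lamination \<Rightarrow> ('m \<times> ('i \<Rightarrow> complex)) set \<Rightarrow> bool" where
  "affine_invariant L X \<longleftrightarrow>
     (\<forall>\<xi>\<in>X. \<forall>b\<in>affine_subgroup. \<forall>\<eta>. right_action L \<xi> b \<eta> \<longrightarrow> \<eta> \<in> X)"

definition affine_minimal_set ::
    "('m, 'i, 't) lamination \<Rightarrow> ('m \<times> ('i \<Rightarrow> complex)) set \<Rightarrow> bool" where
  "affine_minimal_set L X \<longleftrightarrow>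
     X \<noteq> {} \<and> closedin (tangent_topology L) X \<and> affine_invariant L X \<and>
     (\<forall>Y. Y \<subseteq> X \<and> Y \<noteq> {} \<and> closedin (tangent_topology L) Y \<and> affine_invariant L Y \<longrightarrow> Y = X)"

end

theory Submission
  imports Defs
begin

text \<open>
  Write \<open>B\<close> for the affine group. It is the stabilizer of a point of the boundary circle of the
  hyperbolic plane, so the cosets of \<open>B\<close> are the points of that circle, and each fibre of the unit
  tangent bundle is a copy of the circle. For \<open>\<xi>\<close> in \<open>X\<close>, choose an affine coordinate on the circle that
  puts \<open>\<xi>\<close> at infinity, and let \<open>E \<xi>\<close> be the closed set of real coordinates of the remaining points of \<open>X\<close>
  in the fibre of \<open>\<xi>\<close> (\<open>fibre_coordinates\<close> below). By assumption \<open>E \<xi>\<close> is never empty; it has to be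
  shown that it is always the whole line.

  An affine element with entries \<open>a\<close> and \<open>b\<close> that moves \<open>\<xi>\<close> to \<open>\<eta>\<close> maps \<open>E \<eta>\<close> into \<open>E \<xi>\<close> by
  \<open>s \<mapsto> a\<^sup>2 * s + a * b\<close> (\<open>fibre_coordinates_affine\<close>). First, the distance from \<open>0\<close> to \<open>E \<xi>\<close> is bounded
  on \<open>X\<close> (\<open>bounded_fibre_coordinate\<close>): it is finite and lower semicontinuous, hence bounded on a
  nonempty open part of \<open>X\<close> by Baire's theorem; as \<open>X\<close> is minimal and compact, finitely many elements
  of \<open>B\<close> bring every point of \<open>X\<close> into that part, and they change the distance by a bounded amount.
  Second, such a uniform bound forces \<open>E \<xi>\<close> to be the line (\<open>fibre_coordinates_UNIV\<close>): for a
  real number \<open>s0\<close> there are elements of \<open>B\<close> close to the identity that contract the line towards \<open>s0\<close>,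
  and repeated application of one of them brings \<open>E \<xi>\<close> arbitrarily close to \<open>s0\<close>. So \<open>X\<close> contains the
  whole fibre of each of its points, and it meets every fibre.

  The remaining work is to make the geometry available. The action on the bundle is given by chains
  of steps in charts; chains can be composed and reversed, and the argument above uses the action
  through these two operations.
  Analysis enters through two facts: the tangent charts are homeomorphisms, which rests on the
  continuity of the leafwise derivatives of the coordinate changes
  (\<open>continuous_map_moebius_derivative\<close>), and a step is jointly continuous in the vector and in the
  group element (\<open>chart_right_mult_neighbourhood\<close>).
\<close>

section \<open>Moebius transformations and their frames\<close>

definition psl :: "real \<Rightarrow> real \<Rightarrow> real \<Rightarrow> real \<Rightarrow> psl2r" where
  "psl a b c d = abs_psl2r (vector [vector [a, b], vector [c, d]])"

lemma matrix_2x2_eta: "A = vector [vector [A$1$1, A$1$2], vector [A$2$1, A$2$2]]" for A :: "real^2^2"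
  by (simp add: vec_eq_iff forall_2 vector_2)

lemma det_vector_2x2: "det (vector [vector [a, b], vector [c, d]] :: real^2^2) = a * d - b * c"
  by (simp add: det_2 vector_2)

lemma psl_rel_refl_iff: "psl_rel A A \<longleftrightarrow> det A = 1"
  by (simp add: psl_rel_def)

lemma psl_exhaust:
  obtains a b c d where "a * d - b * c = 1" "g = psl a b c d"
proof -
  obtain A where A: "psl_rel A A" "g = abs_psl2r A"
    by (metis Quotient_psl2r Quotient_rep_reflp Quotient_abs_rep)
  show ?thesis
  proof (rule that)
    show "g = psl (A$1$1) (A$1$2) (A$2$1) (A$2$2)"
      unfolding psl_def using A(2) matrix_2x2_eta[of A] by simp
    show "A$1$1 * A$2$2 - A$1$2 * A$2$1 = 1"
      using A(1) by (simp add: psl_rel_refl_iff det_2)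
  qed
qed

lemma psl_mult:
  assumes "a * d - b * c = 1" "a' * d' - b' * c' = 1"
  shows "psl a b c d * psl a' b' c' d' =
    psl (a * a' + b * c') (a * b' + b * d') (c * a' + d * c') (c * b' + d * d')"
proof -
  have "(vector [vector [a, b], vector [c, d]] :: real^2^2) ** vector [vector [a', b'], vector [c', d']]
     = (vector [vector [a * a' + b * c', a * b' + b * d'], vector [c * a' + d * c', c * b' + d * d']] :: real^2^2)"
    by (simp add: vec_eq_iff forall_2 vector_2 matrix_matrix_mult_def sum_2)
  then show ?thesis
    unfolding psl_def
    by (subst times_psl2r.abs_eq) (use assms in \<open>simp_all add: psl_rel_refl_iff det_vector_2x2\<close>)
qed

lemma psl_one: "psl 1 0 0 1 = 1"
proof -
  have "(vector [vector [1, 0], vector [0, 1]] :: real^2^2) = mat 1"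
    by (simp add: vec_eq_iff forall_2 vector_2 mat_def)
  then show ?thesis by (simp add: psl_def one_psl2r.abs_eq)
qed

lemma psl_right_inverse: "\<exists>g'. g * g' = 1 \<and> g' * g = (1 :: psl2r)"
proof -
  obtain a b c d where g: "a * d - b * c = 1" "g = psl a b c d" by (rule psl_exhaust)
  have g': "d * a - (- b) * (- c) = 1" using g(1) by (simp add: mult.commute)
  have "g * psl d (- b) (- c) a = 1" "psl d (- b) (- c) a * g = 1"
    using g by (simp_all only: g(2) psl_mult[OF g(1) g'] psl_mult[OF g' g(1)] psl_one[symmetric])
       (simp_all add: algebra_simps)
  then show ?thesis by blast
qed

lemma moebius_psl:
  assumes "a * d - b * c = 1"
  shows "moebius (psl a b c d) z = (of_real a * z + of_real b) / (of_real c * z + of_real d)"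
  unfolding psl_def
  by (subst moebius.abs_eq) (use assms in \<open>simp_all add: psl_rel_refl_iff det_vector_2x2 vector_2\<close>)

lemma moebius_denominator_nonzero:
  assumes "a * d - b * c = 1" "Im z > 0"
  shows "of_real c * z + of_real d \<noteq> 0"
proof
  assume "of_real c * z + of_real d = 0"
  then have "c * Im z = 0" "c * Re z + d = 0" by (simp_all add: complex_eq_iff)
  with assms show False by auto
qed

lemma moebius_has_derivative:
  assumes "a * d - b * c = 1" "Im z > 0"
  shows "(moebius (psl a b c d) has_field_derivative 1 / (of_real c * z + of_real d)\<^sup>2) (at z)"
proof -
  let ?f = "\<lambda>z. (complex_of_real a * z + of_real b) / (of_real c * z + of_real d)"
  have nz: "of_real c * z + of_real d \<noteq> 0" using assms by (rule moebius_denominator_nonzero)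
  have det: "complex_of_real a * of_real d - of_real b * of_real c = 1"
    using assms(1) by (metis of_real_1 of_real_diff of_real_mult)
  have "(?f has_field_derivative
     (of_real a * (of_real c * z + of_real d) - (of_real a * z + of_real b) * of_real c)
       / ((of_real c * z + of_real d) * (of_real c * z + of_real d))) (at z)"
    by (rule derivative_eq_intros refl | use nz in simp)+
  moreover have "of_real a * (of_real c * z + of_real d) - (of_real a * z + of_real b) * of_real c = (1::complex)"
    using det by (simp add: algebra_simps)
  moreover have "moebius (psl a b c d) = ?f" using assms(1) by (auto simp: moebius_psl)
  ultimately show ?thesis by (simp add: power2_eq_square)
qed

lemma deriv_moebius_psl:
  assumes "a * d - b * c = 1" "Im z > 0"
  shows "deriv (moebius (psl a b c d)) z = 1 / (of_real c * z + of_real d)\<^sup>2"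
  by (rule DERIV_imp_deriv[OF moebius_has_derivative[OF assms]])

lemma moebius_has_deriv:
  assumes "Im z > 0"
  shows "(moebius g has_field_derivative deriv (moebius g) z) (at z)"
proof -
  obtain a b c d where g: "a * d - b * c = 1" "g = psl a b c d" by (rule psl_exhaust)
  show ?thesis
    using moebius_has_derivative[OF g(1) assms] deriv_moebius_psl[OF g(1) assms] g(2) by simp
qed

lemma Im_moebius:
  assumes "Im z > 0"
  shows "Im (moebius g z) = Im z * cmod (deriv (moebius g) z)" "Im (moebius g z) > 0"
proof -
  obtain a b c d where g: "a * d - b * c = 1" "g = psl a b c d" by (rule psl_exhaust)
  have nz: "of_real c * z + of_real d \<noteq> 0" using g(1) assms by (rule moebius_denominator_nonzero)
  have "Im ((of_real a * z + of_real b) / (of_real c * z + of_real d))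
      = Im z * (a * d - b * c) / (cmod (of_real c * z + of_real d))\<^sup>2"
    by (simp add: Im_divide cmod_power2 algebra_simps)
  then show eq: "Im (moebius g z) = Im z * cmod (deriv (moebius g) z)"
    using g by (simp add: moebius_psl deriv_moebius_psl assms norm_divide norm_power)
  show "Im (moebius g z) > 0"
    unfolding eq using assms nz g by (simp add: deriv_moebius_psl norm_divide norm_power)
qed

lemma moebius_diff:
  assumes "a * d - b * c = 1" "Im z > 0" "Im w > 0"
  shows "moebius (psl a b c d) z - moebius (psl a b c d) w
    = (z - w) / ((of_real c * z + of_real d) * (of_real c * w + of_real d))"
proof -
  note nz = moebius_denominator_nonzero[OF assms(1,2)] moebius_denominator_nonzero[OF assms(1,3)]
  have det: "complex_of_real a * of_real d = 1 + of_real b * of_real c"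
    using assms(1) by (metis add.commute diff_add_cancel of_real_1 of_real_add of_real_mult)
  have "(of_real a * z + of_real b) * (of_real c * w + of_real d) - (of_real a * w + of_real b) * (of_real c * z + of_real d)
      = (z - w) * (complex_of_real a * of_real d - of_real b * of_real c)"
    by (simp add: algebra_simps)
  also have "\<dots> = z - w" by (simp add: det)
  finally show ?thesis
    using nz by (simp add: moebius_psl[OF assms(1)] diff_frac_eq)
qed

text \<open>
  For a Moebius transformation the difference \<open>f z - f w\<close> factors as \<open>z - w\<close> times a function of
  \<open>z\<close> times a function of \<open>w\<close>, so suitable quotients of differences isolate \<open>deriv f z\<close>. The
  derivative is thereby a continuous expression in finitely many values of \<open>f\<close>, which turns
  continuity of a family of Moebius transformations into continuity of their derivatives.
\<close>

lemma moebius_derivative_three_points: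
  fixes f g
  assumes "Im z > 0" "Im u > 0" "Im v > 0" "z \<noteq> u" "z \<noteq> v" "u \<noteq> v"
  defines "f \<equiv> moebius g"
  shows "deriv f z = (f z - f u) * (f z - f v) * (u - v) / ((z - u) * (z - v) * (f u - f v))"
    and "f u \<noteq> f v"
proof -
  obtain a b c d where g: "a * d - b * c = 1" "g = psl a b c d" by (rule psl_exhaust)
  note nz = moebius_denominator_nonzero[OF g(1) assms(1)] moebius_denominator_nonzero[OF g(1) assms(2)]
    moebius_denominator_nonzero[OF g(1) assms(3)]
  have key: "1 / A\<^sup>2 = (r / (A * B)) * (s / (A * C)) * t / (r * s * (t / (B * C)))"
    if "A \<noteq> 0" "B \<noteq> 0" "C \<noteq> 0" "r \<noteq> 0" "s \<noteq> 0" "t \<noteq> 0" for A B C r s t :: complex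
    using that by (simp add: power2_eq_square)
  show "deriv f z = (f z - f u) * (f z - f v) * (u - v) / ((z - u) * (z - v) * (f u - f v))"
    unfolding f_def g(2) moebius_diff[OF g(1) assms(1,2)] moebius_diff[OF g(1) assms(1,3)]
      moebius_diff[OF g(1) assms(2,3)] deriv_moebius_psl[OF g(1) assms(1)]
    using key[OF nz, of "z - u" "z - v" "u - v"] assms(4-6) by simp
  have "f u - f v \<noteq> 0"
    unfolding f_def g(2) moebius_diff[OF g(1) assms(2,3)] using nz assms(6) by simp
  then show "f u \<noteq> f v" by simp
qed

lemma moebius_mult:
  assumes "Im z > 0"
  shows "moebius (g * h) z = moebius g (moebius h z)"
proof -
  obtain a b c d where g: "a * d - b * c = 1" "g = psl a b c d" by (rule psl_exhaust)
  obtain a' b' c' d' where h: "a' * d' - b' * c' = 1" "h = psl a' b' c' d'" by (rule psl_exhaust)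
  have det: "(a * a' + b * c') * (c * b' + d * d') - (a * b' + b * d') * (c * a' + d * c') = 1"
  proof -
    have "(a * a' + b * c') * (c * b' + d * d') - (a * b' + b * d') * (c * a' + d * c')
      = (a * d - b * c) * (a' * d' - b' * c')" by (simp add: algebra_simps)
    then show ?thesis using g h by simp
  qed
  have nz: "of_real c' * z + of_real d' \<noteq> 0" using h(1) assms by (rule moebius_denominator_nonzero)
  have "(A * ((A' * z + B') / e) + B) / (C * ((A' * z + B') / e) + D)
      = (A * (A' * z + B') + B * e) / (C * (A' * z + B') + D * e)"
    if "e \<noteq> 0" for A B C D A' B' e :: complex
  proof -
    have "A * ((A' * z + B') / e) + B = (A * (A' * z + B') + B * e) / e"
      "C * ((A' * z + B') / e) + D = (C * (A' * z + B') + D * e) / e"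
      using that by (simp_all add: field_simps)
    then show ?thesis using that by simp
  qed
  from this[OF nz, of "of_real a" "of_real a'" "of_real b'" "of_real b" "of_real c" "of_real d"]
  show ?thesis
    unfolding g(2) h(2) psl_mult[OF g(1) h(1)]
    by (simp add: moebius_psl[OF det] moebius_psl[OF g(1)] moebius_psl[OF h(1)])
      (simp add: algebra_simps)
qed

lemma pushforward_mult:
  assumes "Im (fst p) > 0"
  shows "pushforward (g * h) p = pushforward g (pushforward h p)"
proof -
  let ?z = "fst p"
  have h: "(moebius h has_field_derivative deriv (moebius h) ?z) (at ?z)"
    using assms by (rule moebius_has_deriv)
  have g: "(moebius g has_field_derivative deriv (moebius g) (moebius h ?z)) (at (moebius h ?z))"
    by (rule moebius_has_deriv, rule Im_moebius(2), rule assms)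
  have "((\<lambda>z. moebius g (moebius h z)) has_field_derivative
      deriv (moebius g) (moebius h ?z) * deriv (moebius h) ?z) (at ?z)"
    using DERIV_chain2[OF g h] .
  moreover have "open {z. Im z > 0}" by (simp add: open_halfspace_Im_gt)
  ultimately have "(moebius (g * h) has_field_derivative
      deriv (moebius g) (moebius h ?z) * deriv (moebius h) ?z) (at ?z)"
    by (rule has_field_derivative_transform_within_open) (use assms in \<open>auto simp: moebius_mult\<close>)
  then have "deriv (moebius (g * h)) ?z = deriv (moebius g) (moebius h ?z) * deriv (moebius h) ?z"
    by (rule DERIV_imp_deriv)
  then show ?thesis using assms by (simp add: pushforward_def moebius_mult)
qed

lemma psl_frame_mult: "psl_frame (g * h) = pushforward g (psl_frame h)"
  unfolding psl_frame_def by (rule pushforward_mult) simp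

lemma psl_frame_psl:
  assumes "a * d - b * c = 1"
  shows "psl_frame (psl a b c d) =
    ((of_real a * \<i> + of_real b) / (of_real c * \<i> + of_real d), \<i> / (of_real c * \<i> + of_real d)\<^sup>2)"
  using assms by (simp add: psl_frame_def pushforward_def moebius_psl deriv_moebius_psl)

abbreviation unit_vectors :: "(complex \<times> complex) set" where
  "unit_vectors \<equiv> unit_tangent_over upper_half_plane"

lemma mem_unit_tangent_over:
  "(z, w) \<in> unit_tangent_over D \<longleftrightarrow> z \<in> D \<and> Im z > 0 \<and> cmod w = Im z"
  by (auto simp: unit_tangent_over_def upper_half_plane_def divide_simps)

lemma psl_frame_one: "psl_frame 1 = (\<i>, \<i>)"
  using psl_frame_psl[of 1 1 0 0] by (simp add: psl_one)

lemma pushforward_unit: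
  assumes "p \<in> unit_vectors" shows "pushforward g p \<in> unit_vectors"
proof -
  obtain z w where p: "p = (z, w)" by (cases p)
  have *: "Im z > 0" "cmod w = Im z" using assms by (auto simp: p mem_unit_tangent_over)
  show ?thesis
    using Im_moebius[OF *(1), of g] * by (simp add: p pushforward_def mem_unit_tangent_over upper_half_plane_def norm_mult)
qed

lemma psl_frame_unit: "psl_frame g \<in> unit_vectors"
  unfolding psl_frame_def by (rule pushforward_unit) (simp add: mem_unit_tangent_over upper_half_plane_def)

text \<open>
  The denominator \<open>c * z + d\<close> at \<open>\<i>\<close> is a square root \<open>e\<close> of \<open>\<i> / w\<close>, because the pushforward of \<open>\<i>\<close>
  has to be \<open>w\<close>; the numerator is then forced to be \<open>z * e\<close>.
\<close>

lemma psl_frame_surj: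
  assumes "p \<in> unit_vectors" shows "\<exists>g. psl_frame g = p"
proof -
  obtain z w where p: "p = (z, w)" by (cases p)
  have *: "Im z > 0" "cmod w = Im z" using assms by (auto simp: p mem_unit_tangent_over)
  have w: "w \<noteq> 0" using * by auto
  define e where "e = csqrt (\<i> / w)"
  have e2: "e\<^sup>2 = \<i> / w" by (simp add: e_def)
  then have e0: "e \<noteq> 0" using w by auto
  have "(cmod e)\<^sup>2 = 1 / Im z" using e2 *(2) by (metis norm_divide norm_ii norm_power)
  then have ne: "Im z * ((Re e)\<^sup>2 + (Im e)\<^sup>2) = 1" using * by (simp add: cmod_power2)
  define a b where "a = Im (z * e)" and "b = Re (z * e)"
  have det: "a * Re e - b * Im e = 1"
    using ne by (simp add: a_def b_def algebra_simps power2_eq_square)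
  have "of_real (Im e) * \<i> + of_real (Re e) = e" "of_real a * \<i> + of_real b = z * e"
    by (simp_all add: complex_eq_iff a_def b_def)
  then have "psl_frame (psl a b (Im e) (Re e)) = (z, w)"
    unfolding psl_frame_psl[OF det] using e0 e2 w by (simp add: field_simps)
  then show ?thesis using p by blast
qed

text \<open>
  Right translation of the frame \<open>v\<close> by an element with frame \<open>p\<close>. If \<open>k\<close> has the frame \<open>v\<close>, this is
  \<open>pushforward k p\<close>, and \<open>k\<close> is determined by \<open>v\<close>: in the disk coordinates centred at \<open>\<i>\<close> and at
  \<open>fst v\<close> it is multiplication by the unit number \<open>u\<close>. Writing the translation in terms of \<open>v\<close> alone
  makes its continuity in both arguments visible without a topology on the group.
\<close>

definition frame_translate :: "complex \<times> complex \<Rightarrow> complex \<times> complex \<Rightarrow> complex \<times> complex" where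
  "frame_translate p v =
    (let u = snd v / (\<i> * of_real (Im (fst v))); c = u * ((fst p - \<i>) / (fst p + \<i>))
     in ((fst v - cnj (fst v) * c) / (1 - c),
         (fst v - cnj (fst v)) / (1 - c)\<^sup>2 * (u * (2 * \<i>) / (fst p + \<i>)\<^sup>2) * snd p))"

lemma pushforward_eq_frame_translate:
  assumes p: "Im (fst p) > 0"
  shows "pushforward k p = frame_translate p (psl_frame k)"
proof -
  obtain a b c d where k: "a * d - b * c = 1" "k = psl a b c d" by (rule psl_exhaust)
  define P where "P = fst p"
  define A B C D where ABCD: "A = complex_of_real a" "B = complex_of_real b" "C = complex_of_real c" "D = complex_of_real d"
  have det: "A * D - B * C = 1" using k(1) unfolding ABCD by (metis of_real_1 of_real_diff of_real_mult)
  have nP: "C * P + D \<noteq> 0" unfolding ABCD P_def by (rule moebius_denominator_nonzero[OF k(1) p])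
  have ni: "C * \<i> + D \<noteq> 0" unfolding ABCD by (rule moebius_denominator_nonzero[OF k(1)]) simp
  have ni': "D - C * \<i> \<noteq> 0" using ni unfolding ABCD by (auto simp: complex_eq_iff)
  have Pi: "P + \<i> \<noteq> 0" using p unfolding P_def by (auto simp: complex_eq_iff)
  define z w where "z = (A * \<i> + B) / (C * \<i> + D)" and "w = \<i> / (C * \<i> + D)\<^sup>2"
  have fr: "psl_frame k = (z, w)" by (simp add: k psl_frame_psl z_def w_def ABCD)
  have cz: "cnj z = (B - A * \<i>) / (D - C * \<i>)" by (simp add: z_def ABCD)
  have zz: "z - cnj z = 2 * \<i> / ((C * \<i> + D) * (D - C * \<i>))"
  proof -
    have "z - cnj z = 2 * \<i> * (A * D - B * C) / ((C * \<i> + D) * (D - C * \<i>))"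
      unfolding cz unfolding z_def using ni ni' by (simp add: field_simps)
    then show ?thesis by (simp add: det)
  qed
  have "z - cnj z = 2 * \<i> * of_real (Im z)" by (simp add: complex_eq_iff)
  then have Imz: "\<i> * of_real (Im z) = \<i> / ((C * \<i> + D) * (D - C * \<i>))"
    using zz by (metis mult.assoc mult_left_cancel times_divide_eq_right zero_neq_numeral)
  define u where "u = w / (\<i> * of_real (Im z))"
  have u: "u = (D - C * \<i>) / (C * \<i> + D)"
  proof -
    have "(\<i> / E\<^sup>2) / (\<i> / (E * F)) = F / E" if "E \<noteq> 0" for E F :: complex
      using that by (simp add: power2_eq_square)
    from this[OF ni] show ?thesis unfolding u_def Imz w_def .
  qed
  define q where "q = u * ((P - \<i>) / (P + \<i>))"
  have denominator: "(C * \<i> + D) * (P + \<i>) - (D - C * \<i>) * (P - \<i>) = 2 * \<i> * (C * P + D)"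
    by (simp add: algebra_simps)
  have q1: "1 - q = 2 * \<i> * (C * P + D) / ((C * \<i> + D) * (P + \<i>))"
  proof -
    have "1 - F / E * (R / S) = (E * S - F * R) / (E * S)" if "E \<noteq> 0" "S \<noteq> 0" for E F R S :: complex
      using that by (simp add: diff_divide_distrib)
    from this[OF ni Pi, of "D - C * \<i>" "P - \<i>"] show ?thesis
      unfolding q_def u denominator .
  qed
  have numerator: "(A * \<i> + B) * (P + \<i>) - (B - A * \<i>) * (P - \<i>) = 2 * \<i> * (A * P + B)"
    by (simp add: algebra_simps)
  have z1: "z - cnj z * q = 2 * \<i> * (A * P + B) / ((C * \<i> + D) * (P + \<i>))"
  proof -
    have "G / E - H / F * (F / E * (R / S)) = (G * S - H * R) / (E * S)"
      if "E \<noteq> 0" "F \<noteq> 0" "S \<noteq> 0" for E F G H R S :: complex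
      using that by (simp add: diff_divide_distrib)
    from this[OF ni ni' Pi, of "A * \<i> + B" "B - A * \<i>" "P - \<i>"] show ?thesis
      unfolding q_def u cz unfolding z_def numerator .
  qed
  have 1: "(z - cnj z * q) / (1 - q) = (A * P + B) / (C * P + D)"
    unfolding z1 q1 using ni nP Pi by simp
  have 2: "(z - cnj z) / (1 - q)\<^sup>2 * (u * (2 * \<i>) / (P + \<i>)\<^sup>2) = 1 / (C * P + D)\<^sup>2"
  proof -
    have "2 * \<i> / (E * F) / (2 * \<i> * N / (E * S))\<^sup>2 * (F / E * (2 * \<i>) / S\<^sup>2) = 1 / N\<^sup>2"
      if "E \<noteq> 0" "F \<noteq> 0" "S \<noteq> 0" "N \<noteq> 0" for E F N S :: complex
      using that by (simp add: power2_eq_square)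
    from this[OF ni ni' Pi nP] show ?thesis unfolding zz q1 u .
  qed
  have "pushforward k p = ((A * P + B) / (C * P + D), 1 / (C * P + D)\<^sup>2 * snd p)"
    using k(1) p by (simp add: k(2) pushforward_def moebius_psl deriv_moebius_psl ABCD P_def)
  also have "\<dots> = frame_translate p (psl_frame k)"
    unfolding 1[symmetric] 2[symmetric] fr by (simp add: frame_translate_def Let_def u_def q_def P_def)
  finally show ?thesis .
qed

lemma psl_frame_mult_eq_translate: "psl_frame (k * h) = frame_translate (psl_frame h) (psl_frame k)"
  unfolding psl_frame_mult
  by (rule pushforward_eq_frame_translate) (use psl_frame_unit[of h] in \<open>auto simp: unit_tangent_over_def upper_half_plane_def\<close>)

lemma frame_translate_rotation:
  assumes "Im z > 0"
  shows "frame_translate (\<i>, c * \<i>) (z, w) = (z, c * w)"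
proof -
  have "z - cnj z = 2 * \<i> * of_real (Im z)" by (simp add: complex_eq_iff)
  then show ?thesis using assms by (simp add: frame_translate_def Let_def power2_eq_square) (simp add: algebra_simps)
qed

lemma frame_translate_unit:
  assumes "p \<in> unit_vectors" "v \<in> unit_vectors"
  shows "frame_translate p v \<in> unit_vectors"
  using psl_frame_surj[OF assms(1)] psl_frame_surj[OF assms(2)] psl_frame_mult_eq_translate psl_frame_unit
  by metis

text \<open>
  The only denominator that is not obviously nonzero is \<open>1 - c\<close>; here \<open>\<bar>c\<bar> < 1\<close> because the Cayley
  transform maps the upper half plane into the unit disk.
\<close>

lemma continuous_on_frame_translate:
  "continuous_on (unit_vectors \<times> unit_vectors) (\<lambda>x. frame_translate (fst x) (snd x))"
proof -
  have c: "1 - w / (\<i> * of_real (Im z)) * ((p - \<i>) / (p + \<i>)) \<noteq> 0"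
    if "(p, q) \<in> unit_vectors" "(z, w) \<in> unit_vectors" for p q z w
  proof -
    have *: "Im p > 0" "Im z > 0" "cmod w = Im z" using that by (auto simp: mem_unit_tangent_over)
    have "(cmod (p - \<i>))\<^sup>2 < (cmod (p + \<i>))\<^sup>2" using *(1) by (simp add: cmod_power2) (simp add: power2_eq_square algebra_simps)
    then have "cmod (p - \<i>) < cmod (p + \<i>)" by (rule power2_less_imp_less) simp
    then have "cmod (w / (\<i> * of_real (Im z)) * ((p - \<i>) / (p + \<i>))) < 1"
      using * by (simp add: norm_mult norm_divide divide_simps)
    then show ?thesis by (metis norm_one less_irrefl right_minus_eq)
  qed
  have nz: "Im z \<noteq> 0" "z + \<i> \<noteq> 0" if "(z, w) \<in> unit_vectors" for z w
    using that by (auto simp: mem_unit_tangent_over complex_eq_iff)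
  show ?thesis
    unfolding frame_translate_def Let_def
    by (intro continuous_intros ballI) (auto dest: nz c)
qed

section \<open>Rotations and the affine group\<close>

text \<open>
  A rotation whose first column is proportional to \<open>(s, 1)\<close>. The affine group is the stabilizer of the
  direction \<open>(1, 0)\<close>, so every coset of it other than the group itself contains exactly one
  \<open>rotation s\<close>: the parameter \<open>s\<close> is an affine coordinate on the boundary circle minus one point.
\<close>

definition rotation :: "real \<Rightarrow> psl2r" where
  "rotation s = psl (s / sqrt (1 + s\<^sup>2)) (- 1 / sqrt (1 + s\<^sup>2)) (1 / sqrt (1 + s\<^sup>2)) (s / sqrt (1 + s\<^sup>2))"

text \<open>
  The unit complex number by which \<open>rotation s\<close> turns tangent vectors.
\<close>

definition cayley :: "real \<Rightarrow> complex" where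
  "cayley s = (of_real s - \<i>) / (of_real s + \<i>)"

definition affine_elt :: "real \<Rightarrow> real \<Rightarrow> psl2r" where
  "affine_elt a b = psl a b 0 (1 / a)"

lemma affine_subgroup_iff: "g \<in> affine_subgroup \<longleftrightarrow> (\<exists>a b. a > 0 \<and> g = affine_elt a b)"
  by (auto simp: affine_subgroup_def affine_elt_def psl_def inverse_eq_divide)

lemma affine_elt_mult:
  assumes "a \<noteq> 0" "a' \<noteq> 0"
  shows "affine_elt a b * affine_elt a' b' = affine_elt (a * a') (a * b' + b / a')"
  unfolding affine_elt_def by (subst psl_mult) (use assms in \<open>simp_all add: mult.commute\<close>)

lemma affine_subgroup_mult: "g \<in> affine_subgroup \<Longrightarrow> h \<in> affine_subgroup \<Longrightarrow> g * h \<in> affine_subgroup"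
  unfolding affine_subgroup_iff by (metis affine_elt_mult less_irrefl mult_pos_pos)

lemma one_in_affine_subgroup: "1 \<in> affine_subgroup"
  unfolding affine_subgroup_iff affine_elt_def psl_one[symmetric] by (metis div_by_1 zero_less_one)

lemma sqrt_one_plus_square_pos: "sqrt (1 + s\<^sup>2) > 0" for s :: real
  by (simp add: add_pos_nonneg)

lemma sqrt_one_plus_square_sq: "sqrt (1 + s\<^sup>2) * sqrt (1 + s\<^sup>2) = 1 + s * s" for s :: real
  by (simp add: power2_eq_square)

lemma det_rotation:
  "(s / sqrt (1 + s\<^sup>2)) * (s / sqrt (1 + s\<^sup>2)) - (- 1 / sqrt (1 + s\<^sup>2)) * (1 / sqrt (1 + s\<^sup>2)) = 1" for s :: real
proof -
  have "(s / r) * (s / r) - (- 1 / r) * (1 / r) = (1 + s * s) / (r * r)" for r :: real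
    by (simp add: add_divide_distrib)
  moreover have "1 + s * s \<noteq> 0" by (metis add_pos_nonneg less_irrefl zero_le_square zero_less_one)
  ultimately show ?thesis by (simp only: sqrt_one_plus_square_sq) simp
qed

lemma of_real_plus_i_nonzero: "of_real s + \<i> \<noteq> 0" "of_real s - \<i> \<noteq> 0"
  by (auto simp: complex_eq_iff)

lemma cmod_cayley: "cmod (cayley s) = 1"
proof -
  have "cmod (of_real s - \<i>) = cmod (of_real s + \<i>)" by (simp add: cmod_def)
  then show ?thesis using of_real_plus_i_nonzero(1)[of s] by (simp add: cayley_def norm_divide)
qed

lemma psl_frame_rotation: "psl_frame (rotation s) = (\<i>, cayley s * \<i>)"
proof -
  define r where "r = complex_of_real (sqrt (1 + s\<^sup>2))"
  have r0: "r \<noteq> 0" using sqrt_one_plus_square_pos[of s] by (simp add: r_def)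
  have r2: "r * r = (of_real s + \<i>) * (of_real s - \<i>)"
    unfolding r_def of_real_mult[symmetric] sqrt_one_plus_square_sq by (simp add: algebra_simps)
  note nz = of_real_plus_i_nonzero(1)[of s]
  have e: "complex_of_real (1 / sqrt (1 + s\<^sup>2)) * \<i> + of_real (s / sqrt (1 + s\<^sup>2)) = (of_real s + \<i>) / r"
    "complex_of_real (s / sqrt (1 + s\<^sup>2)) * \<i> + of_real (- 1 / sqrt (1 + s\<^sup>2)) = \<i> * ((of_real s + \<i>) / r)"
    by (simp_all add: r_def add_divide_distrib ring_distribs)
  have "\<i> / ((of_real s + \<i>) / r)\<^sup>2 = (r * r) * \<i> / (of_real s + \<i>)\<^sup>2"
    by (simp add: power2_eq_square)
  also have "\<dots> = cayley s * \<i>"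
    unfolding r2 cayley_def using nz by (simp add: power2_eq_square)
  finally show ?thesis
    unfolding rotation_def psl_frame_psl[OF det_rotation] e using nz r0 by simp
qed

lemma cayley_surj:
  assumes "cmod c = 1" "c \<noteq> 1" shows "\<exists>s. cayley s = c"
proof -
  define x y where "x = Re c" and "y = Im c"
  have xy: "x * x + y * y = 1" using assms(1) by (metis cmod_power2 one_power2 power2_eq_square x_def y_def)
  have x1: "x \<noteq> 1" using xy assms(2) by (auto simp: x_def y_def complex_eq_iff)
  define s where "s = - y / (1 - x)"
  have s: "s * (1 - x) = - y" using x1 by (simp add: s_def)
  have "s * y * (1 - x) = - (y * y)" using s by (metis mult.assoc mult.commute mult_minus_left)
  also have "\<dots> = - (1 + x) * (1 - x)" using xy by (simp add: algebra_simps)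
  finally have sy: "s * y = - (1 + x)" using x1 by simp
  have "c * (of_real s + \<i>) = of_real s - \<i>"
    using s sy by (simp add: complex_eq_iff x_def[symmetric] y_def[symmetric] algebra_simps)
  then show ?thesis
    using of_real_plus_i_nonzero(1)[of s] by (intro exI[of _ s]) (simp add: cayley_def field_simps)
qed

lemma continuous_on_cayley: "continuous_on UNIV cayley"
  unfolding cayley_def by (intro continuous_intros ballI of_real_plus_i_nonzero)

text \<open>
  Left multiplication by an affine element permutes the cosets of the affine group and acts on their
  coordinate \<open>s\<close> as an affine map of the line. This is the mechanism of the whole proof: the affine
  group contains contractions of the line towards any prescribed point.
\<close>

lemma rotation_affine_cocycle:
  assumes "a > 0" and s': "s' = a\<^sup>2 * s + a * b"
  shows "\<exists>b'\<in>affine_subgroup. rotation s' = affine_elt a b * rotation s * b'"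
proof -
  define r r' where "r = sqrt (1 + s\<^sup>2)" and "r' = sqrt (1 + s'\<^sup>2)"
  have r: "r > 0" "r * r = 1 + s * s" and r': "r' > 0" "r' * r' = 1 + s' * s'"
    by (simp_all only: r_def r'_def sqrt_one_plus_square_pos sqrt_one_plus_square_sq)
  \<comment> \<open>The correcting factor is upper triangular; its diagonal is read off the first columns, and its
    corner entry \<open>x\<close> is then determined by the lower right entry.\<close>
  define x where "x = a * r * (s' / r' - s * r' / (a\<^sup>2 * (r * r)))"
  have deta: "a * (1 / a) - b * 0 = 1" using assms(1) by simp
  note dets = det_rotation[of s, folded r_def]
  have rot: "rotation s = psl (s / r) (- 1 / r) (1 / r) (s / r)" "rotation s' = psl (s' / r') (- 1 / r') (1 / r') (s' / r')"
    by (simp_all add: rotation_def r_def r'_def)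
  have 1: "affine_elt a b * rotation s
    = psl (a * (s / r) + b * (1 / r)) (a * (- 1 / r) + b * (s / r)) (0 * (s / r) + 1 / a * (1 / r)) (0 * (- 1 / r) + 1 / a * (s / r))"
    unfolding affine_elt_def rot by (rule psl_mult[OF deta dets])
  have det1: "(a * (s / r) + b * (1 / r)) * (0 * (- 1 / r) + 1 / a * (s / r))
     - (a * (- 1 / r) + b * (s / r)) * (0 * (s / r) + 1 / a * (1 / r)) = 1"
  proof -
    have "(a * (s / r) + b * (1 / r)) * (0 * (- 1 / r) + 1 / a * (s / r))
     - (a * (- 1 / r) + b * (s / r)) * (0 * (s / r) + 1 / a * (1 / r))
     = (s / r) * (s / r) - (- 1 / r) * (1 / r)"
      using assms(1) r(1) by (simp add: field_simps)
    then show ?thesis using dets by simp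
  qed
  have det2: "(a * r / r') * (r' / (a * r)) - x * 0 = 1" using assms(1) r r' by simp
  have e12: "(a * (s / r) + b * (1 / r)) * x + (a * (- 1 / r) + b * (s / r)) * (r' / (a * r)) = - 1 / r'"
  proof -
    have "a * s * a + b * a = s'" using s' by (simp add: power2_eq_square algebra_simps)
    then have f: "a * s + b = s' / a" using assms(1) by (simp add: field_simps)
    have g: "b * s * a = s * s' - a * a * s * s" using s' by (simp add: power2_eq_square algebra_simps)
    have "(a * (s / r) + b * (1 / r)) * x = (a * s + b) / r * x" by (simp add: add_divide_distrib)
    also have "\<dots> = s' * (s' / r' - s * r' / (a * a * (r * r)))"
      unfolding f x_def using assms(1) r(1) by (simp add: power2_eq_square)
    finally have A: "(a * (s / r) + b * (1 / r)) * x = s' * s' / r' - s * s' * r' / (a * a * (r * r))"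
      by (simp add: algebra_simps)
    have "(a * (- 1 / r) + b * (s / r)) * (r' / (a * r)) = (b * s * a - a * a) * r' / (a * a * (r * r))"
      using assms(1) r(1) by (simp add: field_simps)
    also have "\<dots> = (s * s' - a * a * (r * r)) * r' / (a * a * (r * r))"
      unfolding g r(2) by (simp add: algebra_simps)
    also have "\<dots> = s * s' * r' / (a * a * (r * r)) - r'"
      using assms(1) r(1) by (simp add: diff_divide_distrib left_diff_distrib)
    finally have B: "(a * (- 1 / r) + b * (s / r)) * (r' / (a * r)) = s * s' * r' / (a * a * (r * r)) - r'" .
    have "s' * s' / r' - r' = - 1 / r'" using r' by (simp add: field_simps)
    then show ?thesis unfolding A B by simp
  qed
  have e22: "(0 * (s / r) + 1 / a * (1 / r)) * x + (0 * (- 1 / r) + 1 / a * (s / r)) * (r' / (a * r)) = s' / r'"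
    unfolding x_def using assms(1) r(1) by (simp add: power2_eq_square right_diff_distrib)
  have e11: "(a * (s / r) + b * (1 / r)) * (a * r / r') + (a * (- 1 / r) + b * (s / r)) * 0 = s' / r'"
  proof -
    have "a * (s / r) + b * (1 / r) = (a * s + b) / r" by (simp add: add_divide_distrib)
    then have "(a * (s / r) + b * (1 / r)) * (a * r / r') = (a * s + b) * a / r'" using r(1) by simp
    also have "(a * s + b) * a = s'" unfolding s' by (simp add: power2_eq_square algebra_simps)
    finally show ?thesis by simp
  qed
  have e21: "(0 * (s / r) + 1 / a * (1 / r)) * (a * r / r') + (0 * (- 1 / r) + 1 / a * (s / r)) * 0 = 1 / r'"
    using assms(1) r(1) by simp
  have "affine_elt (a * r / r') x = psl (a * r / r') x 0 (r' / (a * r))" by (simp add: affine_elt_def)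
  then have "affine_elt a b * rotation s * affine_elt (a * r / r') x = rotation s'"
    unfolding 1 by (simp only: psl_mult[OF det1 det2] e11 e12 e21 e22 rot)
  moreover have "affine_elt (a * r / r') x \<in> affine_subgroup"
    unfolding affine_subgroup_iff using assms(1) r(1) r'(1)
    by (intro exI[of _ "a * r / r'"] exI[of _ x]) simp
  ultimately show ?thesis by metis
qed

lemma psl_frame_affine_elt:
  assumes "a > 0"
  shows "psl_frame (affine_elt a b) = (of_real (a\<^sup>2) * \<i> + of_real (a * b), of_real (a\<^sup>2) * \<i>)"
proof -
  have "a * (1 / a) - b * 0 = 1" using assms by simp
  from psl_frame_psl[OF this] show ?thesis
    using assms unfolding affine_elt_def by (simp add: power2_eq_square field_simps)
qed

section \<open>Derivatives of continuous families of Moebius transformations\<close>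

lemma continuous_map_complex_mult:
  fixes f g :: "'a \<Rightarrow> complex"
  assumes "continuous_map X euclidean f" "continuous_map X euclidean g"
  shows "continuous_map X euclidean (\<lambda>x. f x * g x)"
  using assms by (simp add: continuous_map_atin tendsto_mult)

lemma continuous_map_complex_divide:
  fixes f g :: "'a \<Rightarrow> complex"
  assumes "continuous_map X euclidean f" "continuous_map X euclidean g"
    and "\<And>x. x \<in> topspace X \<Longrightarrow> g x \<noteq> 0"
  shows "continuous_map X euclidean (\<lambda>x. f x / g x)"
  using assms by (simp add: continuous_map_atin tendsto_divide)

lemma continuous_map_euclidean_pair:
  assumes "continuous_map X euclidean f" "continuous_map X euclidean g"
  shows "continuous_map X euclidean (\<lambda>x. (f x, g x))"
  using continuous_map_pairedI[OF assms] by simp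

text \<open>
  The transversal parameter enters through group elements, which carry no topology; only the values
  of the family are known to be continuous. Near a given point two auxiliary points \<open>u\<close> and \<open>v\<close> can be
  kept fixed, and the three point formula expresses the derivative by values of the family. The
  auxiliary points change from place to place, so the formulas are pasted together.
\<close>

lemma continuous_map_moebius_derivative:
  fixes T :: "'t topology" and g :: "'t \<Rightarrow> psl2r"
  assumes D: "open D" "D \<subseteq> upper_half_plane"
    and A: "openin (prod_topology (top_of_set D) T) A"
    and cont: "continuous_map (subtopology (prod_topology (top_of_set D) T) A) euclidean
        (\<lambda>p. moebius (g (snd p)) (fst p))"
  shows "continuous_map (subtopology (prod_topology (top_of_set D) T) A) euclidean
        (\<lambda>p. deriv (moebius (g (snd p))) (fst p))"
proof -
  let ?P = "prod_topology (top_of_set D) T"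
  define F where "F = (\<lambda>p. moebius (g (snd p)) (fst p))"
  define K where "K = {(B, V, u, v). open B \<and> B \<subseteq> D \<and> openin T V \<and> B \<times> V \<subseteq> A \<and> u \<in> B \<and> v \<in> B \<and> u \<noteq> v}"
  define N where "N = (\<lambda>(B :: complex set, V :: 't set, u, v). (B - {u, v}) \<times> V)"
  define q where "q = (\<lambda>(B :: complex set, V :: 't set, u, v) p.
     (F p - F (u, snd p)) * (F p - F (v, snd p)) * (u - v) /
       ((fst p - u) * (fst p - v) * (F (u, snd p) - F (v, snd p))))"
  have points: "fst p \<in> B" "u \<in> B" "v \<in> B" "fst p \<noteq> u" "fst p \<noteq> v" "u \<noteq> v" "Im (fst p) > 0" "Im u > 0" "Im v > 0"
    if "(B, V, u, v) \<in> K" "p \<in> N (B, V, u, v)" for p B V u v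
  proof -
    show *: "fst p \<in> B" "u \<in> B" "v \<in> B" "fst p \<noteq> u" "fst p \<noteq> v" "u \<noteq> v"
      using that by (auto simp: K_def N_def)
    have "B \<subseteq> upper_half_plane" using that(1) D(2) by (auto simp: K_def)
    with * show "Im (fst p) > 0" "Im u > 0" "Im v > 0" by (auto simp: upper_half_plane_def)
  qed
  have q: "deriv (moebius (g (snd p))) (fst p) = q k p" if k: "k \<in> K" "p \<in> N k" for k p
  proof -
    obtain B V u v where keq: "k = (B, V, u, v)" by (cases k)
    show ?thesis
      using moebius_derivative_three_points(1)[of "fst p" u v "g (snd p)"] points[OF k[unfolded keq]]
      by (simp add: q_def F_def keq)
  qed
  show ?thesis
  proof (rule pasting_lemma[where I=K and T=N and f=q])
    fix k assume k: "k \<in> K"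
    obtain B V u v where keq: "k = (B, V, u, v)" by (cases k)
    have *: "open B" "B \<subseteq> D" "openin T V" "B \<times> V \<subseteq> A" "u \<in> B" "v \<in> B" "u \<noteq> v" using k by (auto simp: K_def keq)
    have "open (B - {u} - {v})" using *(1) by (intro open_delete)
    also have "B - {u} - {v} = B - {u, v}" by blast
    finally have "open (B - {u, v})" .
    then have "openin (top_of_set D) (B - {u, v})" using *(2) by (intro open_subset) auto
    then have oN: "openin ?P (N k)" using *(3) by (simp add: N_def keq openin_prod_Times_iff)
    have NA: "N k \<subseteq> A" using *(4) by (auto simp: N_def keq)
    show "openin (subtopology ?P A) (N k)" using oN NA by (simp add: openin_open_subtopology A)
    have sub: "subtopology (subtopology ?P A) (N k) = subtopology ?P (N k)"
      using NA by (simp add: subtopology_subtopology Int_absorb1)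
    have F: "continuous_map (subtopology ?P (N k)) euclidean F"
      using cont NA unfolding F_def by (rule continuous_map_from_subtopology_mono)
    have Fu: "continuous_map (subtopology ?P (N k)) euclidean (\<lambda>p. F (y, snd p))" if y: "y \<in> B" for y
    proof -
      have "continuous_map (subtopology ?P (N k)) ?P (\<lambda>p. (y, snd p))"
        using y *(2) by (intro continuous_map_pairedI continuous_map_from_subtopology continuous_map_snd) auto
      moreover have "(y, snd p) \<in> A" if "p \<in> N k" for p
        using that *(4) y by (auto simp: N_def keq)
      ultimately have "continuous_map (subtopology ?P (N k)) (subtopology ?P A) (\<lambda>p. (y, snd p))"
        by (auto simp: continuous_map_in_subtopology)
      from continuous_map_compose[OF this cont] show ?thesis by (simp add: F_def o_def)
    qed
    have fst: "continuous_map (subtopology ?P (N k)) euclidean fst"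
      by (metis continuous_map_from_subtopology continuous_map_fst continuous_map_into_fulltopology)
    have qk: "q k = (\<lambda>p. (F p - F (u, snd p)) * (F p - F (v, snd p)) * (u - v) /
       ((fst p - u) * (fst p - v) * (F (u, snd p) - F (v, snd p))))"
      by (simp add: q_def keq)
    have "(fst p - u) * (fst p - v) * (F (u, snd p) - F (v, snd p)) \<noteq> 0" if "p \<in> N k" for p
      using points[OF k[unfolded keq] that[unfolded keq]]
        moebius_derivative_three_points(2)[of "fst p" u v "g (snd p)"] by (simp add: F_def)
    then show "continuous_map (subtopology (subtopology ?P A) (N k)) euclidean (q k)"
      unfolding sub qk
      by (intro continuous_map_complex_divide continuous_map_complex_mult continuous_map_diff
          F Fu fst *(5,6) continuous_map_canonical_const) auto
  next
    fix k k' p assume "k \<in> K" "k' \<in> K" "p \<in> topspace (subtopology ?P A) \<inter> N k \<inter> N k'"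
    then show "q k p = q k' p" using q by (metis IntE)
  next
    fix p assume p: "p \<in> topspace (subtopology ?P A)"
    then have "p \<in> A" by simp
    then obtain B V where BV: "openin (top_of_set D) B" "openin T V" "fst p \<in> B" "snd p \<in> V" "B \<times> V \<subseteq> A"
      using A unfolding openin_prod_topology_alt by (metis prod.collapse)
    have "open B" "B \<subseteq> D" using BV(1) D(1) by (auto simp: openin_open_eq)
    have "infinite B" using \<open>open B\<close> BV(3) finite_imp_not_open by blast
    then obtain u where u: "u \<in> B" "u \<noteq> fst p"
      by (metis finite.emptyI finite_insert finite_subset insertCI subsetI)
    from \<open>infinite B\<close> obtain v where v: "v \<in> B" "v \<noteq> fst p" "v \<noteq> u"
      by (metis finite.emptyI finite_insert finite_subset insertCI subsetI)
    have k: "(B, V, u, v) \<in> K" using BV u v \<open>open B\<close> \<open>B \<subseteq> D\<close> by (auto simp: K_def)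
    have "p \<in> N (B, V, u, v)" using BV u v by (cases p) (auto simp: N_def)
    with k q[OF k this] show "\<exists>k. k \<in> K \<and> p \<in> N k \<and> deriv (moebius (g (snd p))) (fst p) = q k p" by blast
  qed
qed

section \<open>Lamination charts and their tangent vectors\<close>

lemma open_hyp_disk:
  assumes "hyp_disk D"
  shows "open D" "D \<subseteq> upper_half_plane"
proof -
  obtain c r where c: "Im c > 0" and D: "D = {z \<in> upper_half_plane. hyp_dist c z < r}"
    using assms by (auto simp: hyp_disk_def upper_half_plane_def)
  have op: "open upper_half_plane" by (simp add: upper_half_plane_def open_halfspace_Im_gt)
  have "continuous_on upper_half_plane (\<lambda>z. 1 + (cmod (c - z))\<^sup>2 / (2 * Im c * Im z))"
    using c by (intro continuous_intros) (auto simp: upper_half_plane_def)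
  then have "continuous_on upper_half_plane (hyp_dist c)"
    unfolding hyp_dist_def
    by (rule continuous_on_compose2[OF continuous_on_arcosh[OF order_refl]])
      (use c in \<open>auto simp: upper_half_plane_def\<close>)
  then have "open (upper_half_plane \<inter> hyp_dist c -` {..<r})"
    using op by (rule continuous_open_preimage) simp
  moreover have "upper_half_plane \<inter> hyp_dist c -` {..<r} = D" by (auto simp: D)
  ultimately show "open D" by simp
  show "D \<subseteq> upper_half_plane" by (auto simp: D)
qed

locale hyperbolic_lamination =
  fixes L :: "('m, 'i, 't) lamination"
  assumes lamination: "compact_hyperbolic_lamination L"
begin

abbreviation "M \<equiv> lspace L"
abbreviation "I \<equiv> charts L"
abbreviation "U \<equiv> chart_dom L"
abbreviation "D \<equiv> chart_disk L"
abbreviation "T \<equiv> chart_transversal L"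
abbreviation "\<phi> \<equiv> chart_map L"
abbreviation "TM \<equiv> tangent_topology L"
abbreviation "bundle \<equiv> unit_tangent_bundle L"
abbreviation "chart_box i \<equiv> prod_topology (top_of_set (D i)) (T i)"
abbreviation "frame_box i \<equiv> prod_topology (top_of_set (unit_tangent_over (D i))) (T i)"

definition point_of :: "'i \<Rightarrow> complex \<times> 't \<Rightarrow> 'm" where
  "point_of i p = inv_into (U i) (\<phi> i) p"

lemma open_U: "i \<in> I \<Longrightarrow> openin M (U i)"
  and cover: "topspace M = (\<Union>i\<in>I. U i)"
  and disk: "i \<in> I \<Longrightarrow> hyp_disk (D i)"
  and chart_homeomorphic: "i \<in> I \<Longrightarrow> homeomorphic_map (subtopology M (U i)) (chart_box i) (\<phi> i)"
  using lamination by (auto simp: compact_hyperbolic_lamination_def)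

lemma Hausdorff_M: "Hausdorff_space M"
  using lamination metrizable_imp_Hausdorff_space by (auto simp: compact_hyperbolic_lamination_def)

lemma open_D: "i \<in> I \<Longrightarrow> open (D i)" and D_upper: "i \<in> I \<Longrightarrow> D i \<subseteq> upper_half_plane"
  using open_hyp_disk[OF disk] by auto

lemma U_subset: "i \<in> I \<Longrightarrow> U i \<subseteq> topspace M"
  by (rule openin_subset[OF open_U])

lemma topspace_U: "i \<in> I \<Longrightarrow> topspace (subtopology M (U i)) = U i"
  using U_subset by auto

lemma chart_image: "i \<in> I \<Longrightarrow> \<phi> i ` U i = D i \<times> topspace (T i)"
  using homeomorphic_imp_surjective_map[OF chart_homeomorphic, of i] topspace_U[of i] by simp

lemma chart_inj: "i \<in> I \<Longrightarrow> inj_on (\<phi> i) (U i)"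
  using homeomorphic_imp_injective_map[OF chart_homeomorphic, of i] topspace_U[of i] by simp

lemma chart_mem: "i \<in> I \<Longrightarrow> x \<in> U i \<Longrightarrow> \<phi> i x \<in> D i \<times> topspace (T i)"
  using chart_image by blast

lemma point_of_chart: "i \<in> I \<Longrightarrow> x \<in> U i \<Longrightarrow> point_of i (\<phi> i x) = x"
  unfolding point_of_def by (rule inv_into_f_f[OF chart_inj])

lemma chart_point_of: "i \<in> I \<Longrightarrow> p \<in> D i \<times> topspace (T i) \<Longrightarrow> \<phi> i (point_of i p) = p \<and> point_of i p \<in> U i"
  unfolding point_of_def using chart_image by (metis f_inv_into_f inv_into_into)

lemma continuous_chart: "i \<in> I \<Longrightarrow> continuous_map (subtopology M (U i)) (chart_box i) (\<phi> i)"
  using homeomorphic_imp_continuous_map[OF chart_homeomorphic] .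

lemma open_chart_image:
  assumes "i \<in> I" "openin M V" shows "openin (chart_box i) (\<phi> i ` (V \<inter> U i))"
proof -
  have "openin (subtopology M (U i)) (V \<inter> U i)" using assms(2) by (auto simp: openin_subtopology)
  then show ?thesis using homeomorphic_imp_open_map[OF chart_homeomorphic[OF assms(1)]] by (simp add: open_map_def)
qed

lemma chart_image_iff:
  assumes "i \<in> I"
  shows "p \<in> \<phi> i ` (V \<inter> U i) \<longleftrightarrow> p \<in> D i \<times> topspace (T i) \<and> point_of i p \<in> V"
proof
  assume "p \<in> \<phi> i ` (V \<inter> U i)"
  then show "p \<in> D i \<times> topspace (T i) \<and> point_of i p \<in> V"
    using chart_mem[OF assms] point_of_chart[OF assms] by force
next
  assume "p \<in> D i \<times> topspace (T i) \<and> point_of i p \<in> V"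
  then show "p \<in> \<phi> i ` (V \<inter> U i)"
    using chart_point_of[OF assms] by (metis IntI image_eqI)
qed

lemma continuous_point_of: 
  assumes "i \<in> I" shows "continuous_map (chart_box i) M (point_of i)"
  unfolding continuous_map_def
proof (intro conjI allI impI)
  show "point_of i \<in> topspace (chart_box i) \<rightarrow> topspace M"
    using chart_point_of[OF assms] U_subset[OF assms] by (auto simp del: topspace_prod_topology simp: topspace_prod_topology topspace_euclidean_subtopology)
  fix V assume "openin M V"
  then have "openin (chart_box i) (\<phi> i ` (V \<inter> U i))" by (rule open_chart_image[OF assms])
  moreover have "\<phi> i ` (V \<inter> U i) = {p \<in> topspace (chart_box i). point_of i p \<in> V}"
    using chart_image_iff[OF assms] by auto
  ultimately show "openin (chart_box i) {p \<in> topspace (chart_box i). point_of i p \<in> V}" by simp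
qed

lemma transition:
  assumes "i \<in> I" "j \<in> I"
  obtains g h where "\<And>x. x \<in> U i \<inter> U j \<Longrightarrow> \<phi> i x = (moebius (g (snd (\<phi> j x))) (fst (\<phi> j x)), h (snd (\<phi> j x)))"
proof -
  have "\<exists>(g :: 't \<Rightarrow> psl2r) (h :: 't \<Rightarrow> 't). \<forall>(y, t) \<in> \<phi> j ` (U i \<inter> U j).
      \<phi> i (inv_into (U j) (\<phi> j) (y, t)) = (moebius (g t) y, h t)"
    using lamination assms unfolding compact_hyperbolic_lamination_def by blast
  then obtain g :: "'t \<Rightarrow> psl2r" and h :: "'t \<Rightarrow> 't"
    where gh: "\<forall>(y, t) \<in> \<phi> j ` (U i \<inter> U j). \<phi> i (inv_into (U j) (\<phi> j) (y, t)) = (moebius (g t) y, h t)"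
    by blast
  show ?thesis
  proof (rule that)
    fix x assume x: "x \<in> U i \<inter> U j"
    have "\<phi> i (inv_into (U j) (\<phi> j) (fst (\<phi> j x), snd (\<phi> j x))) = (moebius (g (snd (\<phi> j x))) (fst (\<phi> j x)), h (snd (\<phi> j x)))"
      using gh x by force
    then show "\<phi> i x = (moebius (g (snd (\<phi> j x))) (fst (\<phi> j x)), h (snd (\<phi> j x)))"
      using point_of_chart[OF assms(2), of x] x by (simp add: point_of_def)
  qed
qed

text \<open>
  Derivatives of a leafwise change of coordinates only see points of the same plaque, so it must be
  known that near \<open>x\<close> the plaque stays inside an open set that contains \<open>x\<close>.
\<close>

lemma eventually_in_slice:
  assumes "i \<in> I" "openin M V" "x \<in> V" "x \<in> U i"
  shows "\<forall>\<^sub>F y in nhds (fst (\<phi> i x)). (y, snd (\<phi> i x)) \<in> D i \<times> topspace (T i) \<and> point_of i (y, snd (\<phi> i x)) \<in> V \<inter> U i"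
proof -
  have "(fst (\<phi> i x), snd (\<phi> i x)) \<in> \<phi> i ` (V \<inter> U i)" using assms(3,4) by auto
  with open_chart_image[OF assms(1,2)] obtain A B where AB:
    "openin (top_of_set (D i)) A" "fst (\<phi> i x) \<in> A" "snd (\<phi> i x) \<in> B" "A \<times> B \<subseteq> \<phi> i ` (V \<inter> U i)"
    unfolding openin_prod_topology_alt by meson
  have "open A" using AB(1) open_D[OF assms(1)] by (simp add: openin_open_eq)
  then have "\<forall>\<^sub>F y in nhds (fst (\<phi> i x)). y \<in> A" using AB(2) by (rule eventually_nhds_in_open)
  then show ?thesis
  proof (rule eventually_mono)
    fix y assume "y \<in> A"
    then have "(y, snd (\<phi> i x)) \<in> \<phi> i ` (V \<inter> U i)" using AB by blast
    then show "(y, snd (\<phi> i x)) \<in> D i \<times> topspace (T i) \<and> point_of i (y, snd (\<phi> i x)) \<in> V \<inter> U i"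
      using chart_image_iff[OF assms(1)] chart_point_of[OF assms(1)] by blast
  qed
qed

text \<open>
  The factor by which a tangent vector is multiplied when its coordinate in chart \<open>j\<close> at \<open>p\<close> is
  replaced by its coordinate in chart \<open>i\<close>.
\<close>

definition change_deriv :: "'i \<Rightarrow> 'i \<Rightarrow> complex \<times> 't \<Rightarrow> complex" where
  "change_deriv i j p = deriv (leafwise_change L i j (snd p)) (fst p)"

lemma leafwise_change_point_of: "leafwise_change L i j t y = fst (\<phi> i (point_of j (y, t)))"
  by (simp add: leafwise_change_def point_of_def)

lemma change_deriv_moebius:
  assumes "i \<in> I" "j \<in> I" "x \<in> U i \<inter> U j"
    and g: "\<And>x. x \<in> U i \<inter> U j \<Longrightarrow> \<phi> i x = (moebius (g (snd (\<phi> j x))) (fst (\<phi> j x)), h (snd (\<phi> j x)))"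
  shows "change_deriv i j (\<phi> j x) = deriv (moebius (g (snd (\<phi> j x)))) (fst (\<phi> j x))"
  unfolding change_deriv_def
proof (rule deriv_cong_ev[OF _ refl])
  have "\<forall>\<^sub>F y in nhds (fst (\<phi> j x)). (y, snd (\<phi> j x)) \<in> D j \<times> topspace (T j) \<and> point_of j (y, snd (\<phi> j x)) \<in> U i \<inter> U j"
    using assms by (intro eventually_in_slice open_U) auto
  then show "\<forall>\<^sub>F y in nhds (fst (\<phi> j x)). leafwise_change L i j (snd (\<phi> j x)) y = moebius (g (snd (\<phi> j x))) y"
    by (rule eventually_mono) (use chart_point_of[OF assms(2)] g in \<open>simp add: leafwise_change_point_of\<close>)
qed

lemma change_deriv_self:
  assumes "i \<in> I" "x \<in> U i" shows "change_deriv i i (\<phi> i x) = 1"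
proof -
  have "\<forall>\<^sub>F y in nhds (fst (\<phi> i x)). (y, snd (\<phi> i x)) \<in> D i \<times> topspace (T i) \<and> point_of i (y, snd (\<phi> i x)) \<in> U i \<inter> U i"
    using assms by (intro eventually_in_slice open_U) auto
  then have "\<forall>\<^sub>F y in nhds (fst (\<phi> i x)). leafwise_change L i i (snd (\<phi> i x)) y = y"
    by (rule eventually_mono) (use chart_point_of[OF assms(1)] in \<open>simp add: leafwise_change_point_of\<close>)
  then have "change_deriv i i (\<phi> i x) = deriv (\<lambda>y. y) (fst (\<phi> i x))"
    unfolding change_deriv_def by (rule deriv_cong_ev[OF _ refl])
  then show ?thesis by simp
qed

lemma Im_chart_pos: "i \<in> I \<Longrightarrow> x \<in> U i \<Longrightarrow> Im (fst (\<phi> i x)) > 0"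
  using chart_mem D_upper by (fastforce simp: upper_half_plane_def)

text \<open>
  Points near \<open>x\<close> on its plaque for chart \<open>k\<close> lie on a single plaque for chart \<open>j\<close>. Hence the change from
  \<open>k\<close> to \<open>i\<close> is, near \<open>x\<close>, a composition of two fixed Moebius transformations, and the chain rule applies.
\<close>

lemma change_deriv_chain:
  assumes "i \<in> I" "j \<in> I" "k \<in> I" "x \<in> U i" "x \<in> U j" "x \<in> U k"
  shows "change_deriv i k (\<phi> k x) = change_deriv i j (\<phi> j x) * change_deriv j k (\<phi> k x)"
proof -
  obtain g h where g: "\<And>x. x \<in> U i \<inter> U j \<Longrightarrow> \<phi> i x = (moebius (g (snd (\<phi> j x))) (fst (\<phi> j x)), h (snd (\<phi> j x)))"
    using transition[OF assms(1,2)] by metis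
  obtain g' h' where g': "\<And>x. x \<in> U j \<inter> U k \<Longrightarrow> \<phi> j x = (moebius (g' (snd (\<phi> k x))) (fst (\<phi> k x)), h' (snd (\<phi> k x)))"
    using transition[OF assms(2,3)] by metis
  define z t where "z = fst (\<phi> k x)" and "t = snd (\<phi> k x)"
  have x: "\<phi> j x = (moebius (g' t) z, h' t)" using g' assms by (simp add: z_def t_def)
  have Imz: "Im z > 0" unfolding z_def by (rule Im_chart_pos) (use assms in auto)
  have "openin M (U i \<inter> U j)" using open_U assms by blast
  then have "\<forall>\<^sub>F y in nhds z. (y, t) \<in> D k \<times> topspace (T k) \<and> point_of k (y, t) \<in> (U i \<inter> U j) \<inter> U k"
    unfolding z_def t_def using assms by (intro eventually_in_slice) auto
  then have "\<forall>\<^sub>F y in nhds z. leafwise_change L i k t y = moebius (g (h' t)) (moebius (g' t) y)"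
    by (rule eventually_mono) (use chart_point_of[OF assms(3)] g g' in \<open>auto simp: leafwise_change_point_of\<close>)
  then have "change_deriv i k (\<phi> k x) = deriv (\<lambda>y. moebius (g (h' t)) (moebius (g' t) y)) z"
    unfolding change_deriv_def z_def[symmetric] t_def[symmetric] by (rule deriv_cong_ev[OF _ refl])
  also have "\<dots> = deriv (moebius (g (h' t))) (moebius (g' t) z) * deriv (moebius (g' t)) z"
    by (intro DERIV_imp_deriv DERIV_chain2 moebius_has_deriv Im_moebius(2) Imz)
  also have "deriv (moebius (g (h' t))) (moebius (g' t) z) = change_deriv i j (\<phi> j x)"
    using change_deriv_moebius[OF assms(1,2) _ g, of x] assms by (simp add: x)
  also have "deriv (moebius (g' t)) z = change_deriv j k (\<phi> k x)"
    using change_deriv_moebius[OF assms(2,3) _ g', of x] assms by (simp add: z_def t_def)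
  finally show ?thesis .
qed

lemma cmod_change_deriv:
  assumes "i \<in> I" "j \<in> I" "x \<in> U i" "x \<in> U j"
  shows "Im (fst (\<phi> i x)) = Im (fst (\<phi> j x)) * cmod (change_deriv i j (\<phi> j x))"
proof -
  obtain g h where g: "\<And>x. x \<in> U i \<inter> U j \<Longrightarrow> \<phi> i x = (moebius (g (snd (\<phi> j x))) (fst (\<phi> j x)), h (snd (\<phi> j x)))"
    using transition[OF assms(1,2)] by metis
  have x: "x \<in> U i \<inter> U j" using assms(3,4) by (rule IntI)
  have "change_deriv i j (\<phi> j x) = deriv (moebius (g (snd (\<phi> j x)))) (fst (\<phi> j x))"
    using assms(1,2) x g by (rule change_deriv_moebius)
  then show ?thesis
    unfolding arg_cong[OF g[OF x], of fst, unfolded fst_conv]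
    by (simp only: Im_moebius(1)[OF Im_chart_pos[OF assms(2,4)]])
qed

text \<open>
  A tangent vector is a compatible family of coordinates; this is the family that is determined by its
  coordinate \<open>w\<close> in the chart \<open>i\<close>.
\<close>

definition tangent_vector :: "'i \<Rightarrow> 'm \<Rightarrow> complex \<Rightarrow> 'i \<Rightarrow> complex" where
  "tangent_vector i x w = (\<lambda>j. if j \<in> I \<and> x \<in> U j then change_deriv j i (\<phi> i x) * w else 0)"

lemma unit_tangent_iff:
  "v \<in> unit_tangent L x \<longleftrightarrow>
     (\<forall>i. \<not> (i \<in> I \<and> x \<in> U i) \<longrightarrow> v i = 0) \<and>
     (\<forall>i\<in>I. x \<in> U i \<longrightarrow> cmod (v i) = Im (fst (\<phi> i x))) \<and>
     (\<forall>i\<in>I. \<forall>j\<in>I. x \<in> U i \<inter> U j \<longrightarrow> v i = change_deriv i j (\<phi> j x) * v j)"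
proof -
  have "(fst (\<phi> i x), w) \<in> unit_tangent_over (D i) \<longleftrightarrow> cmod w = Im (fst (\<phi> i x))"
    if "i \<in> I" "x \<in> U i" for i w
    using chart_mem[OF that] Im_chart_pos[OF that] by (auto simp: mem_unit_tangent_over)
  then have "(\<forall>i\<in>I. x \<in> U i \<longrightarrow> (fst (\<phi> i x), v i) \<in> unit_tangent_over (D i)) \<longleftrightarrow>
      (\<forall>i\<in>I. x \<in> U i \<longrightarrow> cmod (v i) = Im (fst (\<phi> i x)))" by blast
  then show ?thesis unfolding unit_tangent_def change_deriv_def mem_Collect_eq by (rule arg_cong2[where f="(\<and>)", OF refl arg_cong2[where f="(\<and>)", OF _ refl]])
qed

lemma tangent_vector_self: "i \<in> I \<Longrightarrow> x \<in> U i \<Longrightarrow> tangent_vector i x w i = w"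
  by (simp add: tangent_vector_def change_deriv_self)

lemma tangent_vector_unit:
  assumes "i \<in> I" "x \<in> U i" "cmod w = Im (fst (\<phi> i x))"
  shows "tangent_vector i x w \<in> unit_tangent L x"
  unfolding unit_tangent_iff
proof (intro conjI ballI allI impI)
  fix j assume "\<not> (j \<in> I \<and> x \<in> U j)"
  then show "tangent_vector i x w j = 0" by (auto simp: tangent_vector_def)
next
  fix j assume "j \<in> I" "x \<in> U j"
  then show "cmod (tangent_vector i x w j) = Im (fst (\<phi> j x))"
    using assms cmod_change_deriv[of j i x] by (simp add: tangent_vector_def norm_mult)
next
  fix j k assume "j \<in> I" "k \<in> I" "x \<in> U j \<inter> U k"
  then show "tangent_vector i x w j = change_deriv j k (\<phi> k x) * tangent_vector i x w k"
    using change_deriv_chain[of j k i x] assms(1,2) by (simp add: tangent_vector_def)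
qed

lemma unit_tangent_eq_tangent_vector:
  assumes "v \<in> unit_tangent L x" "i \<in> I" "x \<in> U i"
  shows "v = tangent_vector i x (v i)"
proof
  fix j show "v j = tangent_vector i x (v i) j"
  proof (cases "j \<in> I \<and> x \<in> U j")
    case True
    then have "v j = change_deriv j i (\<phi> i x) * v i" using assms unfolding unit_tangent_iff by blast
    with True show ?thesis by (simp add: tangent_vector_def)
  next
    case False
    then have "v j = 0" using assms(1) unfolding unit_tangent_iff by blast
    with False show ?thesis by (auto simp: tangent_vector_def)
  qed
qed

text \<open>
The inverse of \<open>tangent_chart L i\<close>.
\<close>

definition tangent_point :: "'i \<Rightarrow> (complex \<times> complex) \<times> 't \<Rightarrow> 'm \<times> ('i \<Rightarrow> complex)" where
  "tangent_point i p =
    (let x = point_of i (fst (fst p), snd p) in (x, tangent_vector i x (snd (fst p))))"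

definition bundle_over :: "'i \<Rightarrow> ('m \<times> ('i \<Rightarrow> complex)) set" where
  "bundle_over i = {\<xi> \<in> bundle. fst \<xi> \<in> U i}"

lemma mem_bundle: "\<xi> \<in> bundle \<longleftrightarrow> fst \<xi> \<in> topspace M \<and> snd \<xi> \<in> unit_tangent L (fst \<xi>)"
  by (cases \<xi>) (simp add: unit_tangent_bundle_def)

lemma tangent_chart_mem:
  assumes "i \<in> I" "\<xi> \<in> bundle_over i"
  shows "tangent_chart L i \<xi> \<in> topspace (frame_box i)"
proof -
  have x: "fst \<xi> \<in> U i" and v: "snd \<xi> \<in> unit_tangent L (fst \<xi>)"
    using assms(2) by (simp_all add: bundle_over_def mem_bundle)
  have "cmod (snd \<xi> i) = Im (fst (\<phi> i (fst \<xi>)))"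
    using v x assms(1) unfolding unit_tangent_iff by blast
  then show ?thesis
    using chart_mem[OF assms(1) x] Im_chart_pos[OF assms(1) x]
    by (simp add: tangent_chart_def mem_unit_tangent_over mem_Times_iff)
qed

lemma tangent_point_chart:
  assumes "i \<in> I" "\<xi> \<in> bundle_over i"
  shows "tangent_point i (tangent_chart L i \<xi>) = \<xi>"
proof -
  have x: "fst \<xi> \<in> U i" and v: "snd \<xi> \<in> unit_tangent L (fst \<xi>)"
    using assms(2) by (simp_all add: bundle_over_def mem_bundle)
  show ?thesis
    using unit_tangent_eq_tangent_vector[OF v assms(1) x]
    by (simp add: tangent_point_def tangent_chart_def point_of_chart[OF assms(1) x] Let_def prod_eq_iff)
qed

lemma tangent_point_mem:
  assumes "i \<in> I" "p \<in> topspace (frame_box i)"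
  shows "tangent_point i p \<in> bundle_over i" "tangent_chart L i (tangent_point i p) = p"
proof -
  obtain z w t where p: "p = ((z, w), t)" by (metis prod.collapse)
  have zt: "(z, t) \<in> D i \<times> topspace (T i)" "Im z > 0" "cmod w = Im z"
    using assms(2) by (auto simp: p mem_unit_tangent_over)
  note c = chart_point_of[OF assms(1) zt(1)]
  show "tangent_point i p \<in> bundle_over i"
    using c zt tangent_vector_unit[OF assms(1), of "point_of i (z, t)" w] U_subset[OF assms(1)]
    by (simp add: p tangent_point_def Let_def bundle_over_def mem_bundle subset_iff)
  show "tangent_chart L i (tangent_point i p) = p"
    using c tangent_vector_self[OF assms(1)] by (simp add: p tangent_point_def Let_def tangent_chart_def)
qed

lemma continuous_chart_change:
  assumes "i \<in> I" "j \<in> I"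
  shows "continuous_map (subtopology (chart_box j) (\<phi> j ` (U i \<inter> U j))) (chart_box i) (\<lambda>p. \<phi> i (point_of j p))"
proof -
  let ?A = "\<phi> j ` (U i \<inter> U j)"
  have "continuous_map (subtopology (chart_box j) ?A) M (point_of j)"
    by (intro continuous_map_from_subtopology continuous_point_of assms)
  then have "continuous_map (subtopology (chart_box j) ?A) (subtopology M (U i)) (point_of j)"
    using chart_image_iff[OF assms(2)] by (auto simp: continuous_map_in_subtopology)
  from continuous_map_compose[OF this continuous_chart[OF assms(1)]]
  show ?thesis by (simp add: o_def)
qed

lemma continuous_change_deriv:
  assumes "i \<in> I" "j \<in> I"
  shows "continuous_map (subtopology (chart_box j) (\<phi> j ` (U i \<inter> U j))) euclidean (change_deriv i j)"
proof -
  let ?A = "\<phi> j ` (U i \<inter> U j)"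
  obtain g h where g: "\<And>x. x \<in> U i \<inter> U j \<Longrightarrow> \<phi> i x = (moebius (g (snd (\<phi> j x))) (fst (\<phi> j x)), h (snd (\<phi> j x)))"
    using transition[OF assms] by metis
  have oA: "openin (chart_box j) ?A" using assms by (intro open_chart_image open_U)
  have "continuous_map (subtopology (chart_box j) ?A) (top_of_set (D i)) (\<lambda>p. fst (\<phi> i (point_of j p)))"
    using continuous_map_compose[OF continuous_chart_change[OF assms] continuous_map_fst] by (simp add: o_def)
  then have "continuous_map (subtopology (chart_box j) ?A) euclidean (\<lambda>p. fst (\<phi> i (point_of j p)))"
    by (rule continuous_map_into_fulltopology)
  then have "continuous_map (subtopology (chart_box j) ?A) euclidean (\<lambda>p. moebius (g (snd p)) (fst p))"
    by (rule continuous_map_eq)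
      (use g point_of_chart[OF assms(2)] in auto)
  then have "continuous_map (subtopology (chart_box j) ?A) euclidean (\<lambda>p. deriv (moebius (g (snd p))) (fst p))"
    by (intro continuous_map_moebius_derivative open_D D_upper assms oA)
  then show ?thesis
    by (rule continuous_map_eq) (use change_deriv_moebius[OF assms _ g] in auto)
qed

section \<open>The topology of the unit tangent bundle\<close>

lemma topspace_TM: "topspace TM = bundle"
proof
  show "topspace TM \<subseteq> bundle" by (auto simp: tangent_topology_def)
  show "bundle \<subseteq> topspace TM"
  proof
    fix \<xi> assume \<xi>: "\<xi> \<in> bundle"
    then obtain i where i: "i \<in> I" "fst \<xi> \<in> U i" using cover by (auto simp: mem_bundle)
    then have "tangent_chart L i \<xi> \<in> topspace (frame_box i)"
      using \<xi> by (intro tangent_chart_mem) (auto simp: bundle_over_def)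
    then show "\<xi> \<in> topspace TM"
      unfolding tangent_topology_def topology_generated_by_topspace using \<xi> i
      by (intro UnionI[of "{\<xi> \<in> bundle. fst \<xi> \<in> U i \<and> tangent_chart L i \<xi> \<in> topspace (frame_box i)}"])
         (blast, simp)
  qed
qed

lemma bundle_over_cover: "\<xi> \<in> bundle \<Longrightarrow> \<exists>i\<in>I. \<xi> \<in> bundle_over i"
  using cover by (auto simp: mem_bundle bundle_over_def)

lemma open_tangent_chart_preimage:
  assumes "i \<in> I" "openin (frame_box i) W"
  shows "openin TM {\<xi> \<in> bundle_over i. tangent_chart L i \<xi> \<in> W}"
proof -
  have "{\<xi> \<in> bundle_over i. tangent_chart L i \<xi> \<in> W} = {\<xi> \<in> bundle. fst \<xi> \<in> U i \<and> tangent_chart L i \<xi> \<in> W}"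
    by (auto simp: bundle_over_def)
  then show ?thesis
    unfolding tangent_topology_def using assms by (intro topology_generated_by_Basis) blast
qed

lemma open_bundle_over:
  assumes "i \<in> I" shows "openin TM (bundle_over i)"
proof -
  have "bundle_over i = {\<xi> \<in> bundle_over i. tangent_chart L i \<xi> \<in> topspace (frame_box i)}"
    using tangent_chart_mem[OF assms] by blast
  then show ?thesis using open_tangent_chart_preimage[OF assms openin_topspace] by simp
qed

lemma topspace_bundle_over: "i \<in> I \<Longrightarrow> topspace (subtopology TM (bundle_over i)) = bundle_over i"
  using openin_subset[OF open_bundle_over] by auto

lemma continuous_tangent_chart:
  assumes "i \<in> I"
  shows "continuous_map (subtopology TM (bundle_over i)) (frame_box i) (tangent_chart L i)"
  unfolding continuous_map_def topspace_bundle_over[OF assms] openin_open_subtopology[OF open_bundle_over[OF assms]]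
  using tangent_chart_mem[OF assms] open_tangent_chart_preimage[OF assms] by blast

lemma continuous_base_coordinates:
  "continuous_map (frame_box i) (chart_box i) (\<lambda>p. (fst (fst p), snd p))"
proof -
  have "continuous_map (top_of_set (unit_tangent_over (D i))) (top_of_set (D i)) fst"
    by (auto simp: unit_tangent_over_def intro: continuous_intros)
  from continuous_map_compose[OF continuous_map_fst this]
  have "continuous_map (frame_box i) (top_of_set (D i)) (\<lambda>p. fst (fst p))" by (simp add: o_def)
  then show ?thesis by (intro continuous_map_pairedI continuous_map_snd)
qed

text \<open>
  Together with \<open>continuous_tangent_chart\<close> this says that the tangent charts are homeomorphisms. The
  content is that a subbasic set coming from another chart is open in this one, and there the
  continuity of the derivatives of the coordinate changes enters.
\<close>

lemma continuous_tangent_point: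
  assumes i: "i \<in> I"
  shows "continuous_map (frame_box i) TM (tangent_point i)"
  unfolding tangent_topology_def
proof (rule continuous_on_generated_topo)
  fix \<V> assume "\<V> \<in> {{\<xi> \<in> bundle. fst \<xi> \<in> U j \<and> tangent_chart L j \<xi> \<in> W} | j W. j \<in> I \<and> openin (frame_box j) W}"
  then obtain j W where j: "j \<in> I" and W: "openin (frame_box j) W"
    and \<V>: "\<V> = {\<xi> \<in> bundle. fst \<xi> \<in> U j \<and> tangent_chart L j \<xi> \<in> W}" by blast
  let ?A = "\<phi> i ` (U j \<inter> U i)"
  define \<pi> where "\<pi> = (\<lambda>p :: (complex \<times> complex) \<times> 't. (fst (fst p), snd p))"
  define Q where "Q = {p \<in> topspace (frame_box i). \<pi> p \<in> ?A}"
  have \<pi>: "continuous_map (frame_box i) (chart_box i) \<pi>"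
    unfolding \<pi>_def by (rule continuous_base_coordinates)
  have oQ: "openin (frame_box i) Q"
    unfolding Q_def by (rule openin_continuous_map_preimage[OF \<pi>]) (intro open_chart_image open_U i j)
  have tQ: "topspace (subtopology (frame_box i) Q) = Q" using openin_subset[OF oQ] by auto
  have \<pi>Q: "continuous_map (subtopology (frame_box i) Q) (subtopology (chart_box i) ?A) \<pi>"
    unfolding continuous_map_in_subtopology tQ using continuous_map_from_subtopology[OF \<pi>] by (auto simp: Q_def)
  have a: "continuous_map (subtopology (frame_box i) Q) (chart_box j) (\<lambda>p. \<phi> j (point_of i (\<pi> p)))"
    using continuous_map_compose[OF \<pi>Q continuous_chart_change[OF j i]] by (simp add: o_def)
  have a1: "continuous_map (subtopology (frame_box i) Q) euclidean (\<lambda>p. fst (\<phi> j (point_of i (\<pi> p))))"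
    using continuous_map_compose[OF a continuous_map_fst] continuous_map_into_fulltopology by (fastforce simp: o_def)
  have a2: "continuous_map (subtopology (frame_box i) Q) (T j) (\<lambda>p. snd (\<phi> j (point_of i (\<pi> p))))"
    using continuous_map_compose[OF a continuous_map_snd] by (simp add: o_def)
  have d: "continuous_map (subtopology (frame_box i) Q) euclidean (\<lambda>p. change_deriv j i (\<pi> p))"
    using continuous_map_compose[OF \<pi>Q continuous_change_deriv[OF j i]] by (simp add: o_def)
  have w: "continuous_map (subtopology (frame_box i) Q) euclidean (\<lambda>p. snd (fst p))"
  proof -
    have "continuous_map (frame_box i) (top_of_set (unit_tangent_over (D i))) fst" by (rule continuous_map_fst)
    then have "continuous_map (frame_box i) (prod_topology euclidean euclidean) fst"
      unfolding prod_topology_euclidean by (rule continuous_map_into_fulltopology)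
    then have "continuous_map (frame_box i) euclidean (snd \<circ> fst)" by (simp only: continuous_map_pairwise)
    then show ?thesis by (simp add: o_def continuous_map_from_subtopology)
  qed
  define \<tau> where "\<tau> = (\<lambda>p. ((fst (\<phi> j (point_of i (\<pi> p))), change_deriv j i (\<pi> p) * snd (fst p)), snd (\<phi> j (point_of i (\<pi> p)))))"
  have x: "point_of i (\<pi> p) \<in> U i \<inter> U j" "\<phi> i (point_of i (\<pi> p)) = \<pi> p" if "p \<in> Q" for p
    using that chart_image_iff[OF i, of "\<pi> p" "U j"] chart_point_of[OF i, of "\<pi> p"] by (auto simp: Q_def)
  have \<tau>: "\<tau> p = tangent_chart L j (tangent_point i p)" if "p \<in> Q" for p
    using x[OF that] j
    by (simp add: \<tau>_def tangent_chart_def tangent_point_def Let_def tangent_vector_def \<pi>_def)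
  have over: "tangent_point i p \<in> bundle_over j" if "p \<in> Q" for p
    using tangent_point_mem(1)[OF i, of p] x[OF that] that
    by (auto simp: Q_def bundle_over_def tangent_point_def Let_def \<pi>_def)
  have "continuous_map (subtopology (frame_box i) Q) euclidean
      (\<lambda>p. (fst (\<phi> j (point_of i (\<pi> p))), change_deriv j i (\<pi> p) * snd (fst p)))"
    by (intro continuous_map_euclidean_pair continuous_map_complex_mult a1 d w)
  moreover have "fst (\<tau> p) \<in> unit_tangent_over (D j)" if "p \<in> Q" for p
    using tangent_chart_mem[OF j over[OF that]] \<tau>[OF that] by (auto simp: mem_Times_iff)
  ultimately have "continuous_map (subtopology (frame_box i) Q) (top_of_set (unit_tangent_over (D j)))
      (\<lambda>p. (fst (\<phi> j (point_of i (\<pi> p))), change_deriv j i (\<pi> p) * snd (fst p)))"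
    unfolding continuous_map_in_subtopology tQ by (simp add: \<tau>_def)
  then have \<tau>c: "continuous_map (subtopology (frame_box i) Q) (frame_box j) \<tau>"
    unfolding \<tau>_def by (intro continuous_map_pairedI a2)
  have "openin (subtopology (frame_box i) Q) {p \<in> Q. \<tau> p \<in> W}"
    using openin_continuous_map_preimage[OF \<tau>c W] unfolding tQ .
  then have "openin (frame_box i) {p \<in> Q. \<tau> p \<in> W}" using oQ by (rule openin_trans_full)
  moreover have "{p \<in> Q. \<tau> p \<in> W} = tangent_point i -` \<V> \<inter> topspace (frame_box i)"
  proof (intro set_eqI iffI)
    fix p assume "p \<in> {p \<in> Q. \<tau> p \<in> W}"
    then have p: "p \<in> Q" "\<tau> p \<in> W" by auto
    then show "p \<in> tangent_point i -` \<V> \<inter> topspace (frame_box i)"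
      using over[OF p(1)] \<tau>[OF p(1)] by (auto simp: \<V> bundle_over_def Q_def)
  next
    fix p assume p: "p \<in> tangent_point i -` \<V> \<inter> topspace (frame_box i)"
    then have "\<pi> p \<in> D i \<times> topspace (T i)" by (auto simp: \<pi>_def mem_unit_tangent_over)
    moreover have "point_of i (\<pi> p) \<in> U j" using p by (simp add: \<V> tangent_point_def Let_def \<pi>_def)
    ultimately have "p \<in> Q" using p chart_image_iff[OF i, of "\<pi> p" "U j"] by (simp add: Q_def)
    then show "p \<in> {p \<in> Q. \<tau> p \<in> W}" using p \<tau> by (simp add: \<V>)
  qed
  ultimately show "openin (frame_box i) (tangent_point i -` \<V> \<inter> topspace (frame_box i))" by simp
next
  have "tangent_point i ` topspace (frame_box i) \<subseteq> topspace TM"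
    unfolding topspace_TM using tangent_point_mem(1)[OF i] by (auto simp: bundle_over_def)
  then show "tangent_point i ` topspace (frame_box i)
      \<subseteq> \<Union> {{\<xi> \<in> bundle. fst \<xi> \<in> U j \<and> tangent_chart L j \<xi> \<in> W} | j W. j \<in> I \<and> openin (frame_box j) W}"
    unfolding tangent_topology_def topology_generated_by_topspace .
qed

lemma continuous_base_point: "continuous_map TM M fst"
  unfolding continuous_map_def
proof (intro conjI allI impI)
  show "fst \<in> topspace TM \<rightarrow> topspace M" by (auto simp: topspace_TM mem_bundle)
  fix V assume V: "openin M V"
  have "{\<xi> \<in> topspace TM. fst \<xi> \<in> V} =
     (\<Union>i\<in>I. {\<xi> \<in> bundle_over i. tangent_chart L i \<xi> \<in> {p \<in> topspace (frame_box i). (fst (fst p), snd p) \<in> \<phi> i ` (V \<inter> U i)}})"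
    (is "?l = ?r")
  proof (intro set_eqI iffI)
    fix \<xi> assume \<xi>: "\<xi> \<in> ?l"
    then obtain i where i: "i \<in> I" "\<xi> \<in> bundle_over i" using bundle_over_cover[of \<xi>] by (auto simp: topspace_TM)
    then have "tangent_chart L i \<xi> \<in> topspace (frame_box i)" by (rule tangent_chart_mem)
    moreover have "(fst (fst (tangent_chart L i \<xi>)), snd (tangent_chart L i \<xi>)) \<in> \<phi> i ` (V \<inter> U i)"
      using \<xi> i by (simp add: tangent_chart_def bundle_over_def)
    ultimately show "\<xi> \<in> ?r" using i by blast
  next
    fix \<xi> assume "\<xi> \<in> ?r"
    then obtain i where i: "i \<in> I" "\<xi> \<in> bundle_over i" "\<phi> i (fst \<xi>) \<in> \<phi> i ` (V \<inter> U i)"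
      by (auto simp: tangent_chart_def)
    then have "fst \<xi> \<in> V"
      using chart_inj[OF i(1)] by (auto simp: bundle_over_def inj_on_def)
    then show "\<xi> \<in> ?l" using i by (simp add: topspace_TM bundle_over_def)
  qed
  moreover have "openin TM ?r"
  proof (rule openin_Union)
    fix S assume "S \<in> (\<lambda>i. {\<xi> \<in> bundle_over i. tangent_chart L i \<xi> \<in> {p \<in> topspace (frame_box i). (fst (fst p), snd p) \<in> \<phi> i ` (V \<inter> U i)}}) ` I"
    then obtain i where i: "i \<in> I" and S: "S = {\<xi> \<in> bundle_over i. tangent_chart L i \<xi> \<in> {p \<in> topspace (frame_box i). (fst (fst p), snd p) \<in> \<phi> i ` (V \<inter> U i)}}"
      by blast
    show "openin TM S"
      unfolding S by (intro open_tangent_chart_preimage i openin_continuous_map_preimage[OF continuous_base_coordinates] open_chart_image V)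
  qed
  ultimately show "openin TM {\<xi> \<in> topspace TM. fst \<xi> \<in> V}" by simp
qed

text \<open>
  Vectors over different points are separated in \<open>M\<close>; vectors over the same point differ in the
  coordinate of any chart.
\<close>

lemma Hausdorff_TM: "Hausdorff_space TM"
  unfolding Hausdorff_space_def
proof (intro allI impI, elim conjE)
  fix \<xi> \<eta> assume \<xi>: "\<xi> \<in> topspace TM" and \<eta>: "\<eta> \<in> topspace TM" and ne: "\<xi> \<noteq> \<eta>"
  show "\<exists>A B. openin TM A \<and> openin TM B \<and> \<xi> \<in> A \<and> \<eta> \<in> B \<and> disjnt A B"
  proof (cases "fst \<xi> = fst \<eta>")
    case False
    moreover have "fst \<xi> \<in> topspace M" "fst \<eta> \<in> topspace M" using \<xi> \<eta> by (auto simp: topspace_TM mem_bundle)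
    ultimately obtain A B where AB: "openin M A" "openin M B" "fst \<xi> \<in> A" "fst \<eta> \<in> B" "disjnt A B"
      using Hausdorff_M unfolding Hausdorff_space_def by blast
    show ?thesis
      using AB \<xi> \<eta> openin_continuous_map_preimage[OF continuous_base_point AB(1)]
        openin_continuous_map_preimage[OF continuous_base_point AB(2)]
      by (intro exI[of _ "{\<xi> \<in> topspace TM. fst \<xi> \<in> A}"] exI[of _ "{\<xi> \<in> topspace TM. fst \<xi> \<in> B}"])
        (auto simp: disjnt_iff)
  next
    case True
    obtain i where i: "i \<in> I" "\<xi> \<in> bundle_over i" using bundle_over_cover[of \<xi>] \<xi> by (auto simp: topspace_TM)
    then have i': "\<eta> \<in> bundle_over i" using \<eta> True by (simp add: bundle_over_def topspace_TM)
    have "tangent_chart L i \<xi> \<noteq> tangent_chart L i \<eta>"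
      using ne tangent_point_chart i i' by metis
    then have ne': "fst (tangent_chart L i \<xi>) \<noteq> fst (tangent_chart L i \<eta>)"
      using True by (simp add: tangent_chart_def)
    then obtain A B where AB: "open A" "open B" "fst (tangent_chart L i \<xi>) \<in> A" "fst (tangent_chart L i \<eta>) \<in> B" "A \<inter> B = {}"
      using hausdorff[OF ne'] by blast
    define E where "E C = {\<zeta> \<in> bundle_over i. tangent_chart L i \<zeta> \<in> {p \<in> topspace (frame_box i). fst p \<in> unit_tangent_over (D i) \<inter> C}}" for C
    have E_open: "openin TM (E C)" if "open C" for C
      unfolding E_def
      by (intro open_tangent_chart_preimage i openin_continuous_map_preimage[OF continuous_map_fst] openin_open_Int that)
    have E_iff: "\<zeta> \<in> E C \<longleftrightarrow> \<zeta> \<in> bundle_over i \<and> fst (tangent_chart L i \<zeta>) \<in> C" for \<zeta> C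
      using tangent_chart_mem[OF i(1), of \<zeta>] by (auto simp: E_def mem_Times_iff)
    show ?thesis
    proof (intro exI conjI)
      show "openin TM (E A)" "openin TM (E B)" using AB by (simp_all only: E_open)
      show "\<xi> \<in> E A" "\<eta> \<in> E B" using AB i i' by (simp_all only: E_iff simp_thms)
      have "\<zeta> \<notin> E B" if "\<zeta> \<in> E A" for \<zeta>
        using that AB(5) by (simp only: E_iff) blast
      then show "disjnt (E A) (E B)" by (simp only: disjnt_iff) simp
    qed
  qed
qed

section \<open>The right action\<close>

text \<open>
  One step of the action is continuous in the tangent vector and in the group element together. The
  group element is compared with \<open>h\<close> through its frame. With \<open>V\<close> a neighbourhood this gives openness of
  the action of \<open>h\<close>; with \<open>V\<close> the whole bundle it gives existence of the step for all nearby vectors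
  and group elements.
\<close>

lemma chart_right_mult_neighbourhood:
  assumes step: "chart_right_mult L \<xi> h \<zeta>" and V: "openin TM V" "\<zeta> \<in> V"
  obtains N e where "openin TM N" "\<xi> \<in> N" "e > 0"
    "\<And>h' \<xi>'. dist (psl_frame h') (psl_frame h) < e \<Longrightarrow> \<xi>' \<in> N \<Longrightarrow> \<exists>\<zeta>'\<in>V. chart_right_mult L \<xi>' h' \<zeta>'"
proof -
  obtain i k t where i: "i \<in> I" "\<xi> \<in> bundle_over i" "\<zeta> \<in> bundle_over i"
    and kt: "tangent_chart L i \<xi> = (psl_frame k, t)" "tangent_chart L i \<zeta> = (psl_frame (k * h), t)"
    using step unfolding chart_right_mult_def bundle_over_def by blast
  define F where "F = prod_topology (top_of_set unit_vectors) (T i)"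
  define G where "G = (\<lambda>x :: (complex \<times> complex) \<times> (complex \<times> complex) \<times> 't. (frame_translate (fst x) (fst (snd x)), snd (snd x)))"
  let ?S = "prod_topology (top_of_set unit_vectors) (frame_box i)"
  have subset: "unit_tangent_over (D i) \<subseteq> unit_vectors" by (auto simp: unit_tangent_over_def)
  have G: "continuous_map ?S F G"
  proof -
    have pair: "continuous_map ?S (prod_topology (top_of_set unit_vectors) (top_of_set unit_vectors)) (\<lambda>x. (fst x, fst (snd x)))"
    proof (intro continuous_map_pairedI continuous_map_fst)
      have "continuous_map (top_of_set (unit_tangent_over (D i))) (top_of_set unit_vectors) id"
        using subset by (auto intro: continuous_intros)
      from continuous_map_compose[OF continuous_map_compose[OF continuous_map_snd continuous_map_fst] this]
      show "continuous_map ?S (top_of_set unit_vectors) (\<lambda>x. fst (snd x))" by (simp add: o_def)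
    qed
    have "continuous_map (prod_topology (top_of_set unit_vectors) (top_of_set unit_vectors)) (top_of_set unit_vectors)
        (\<lambda>x. frame_translate (fst x) (snd x))"
      using continuous_on_frame_translate frame_translate_unit by auto
    from continuous_map_compose[OF pair this]
    have "continuous_map ?S (top_of_set unit_vectors) (\<lambda>x. frame_translate (fst x) (fst (snd x)))"
      by (simp add: o_def)
    then show ?thesis
      unfolding G_def F_def
      using continuous_map_compose[OF continuous_map_snd continuous_map_snd, of "top_of_set unit_vectors" "top_of_set (unit_tangent_over (D i))" "T i"]
      by (intro continuous_map_pairedI) (auto simp: o_def)
  qed
  define W where "W = {p \<in> topspace (frame_box i). tangent_point i p \<in> V}"
  have "openin (frame_box i) W"
    unfolding W_def by (rule openin_continuous_map_preimage[OF continuous_tangent_point[OF i(1)] V(1)])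
  moreover have "frame_box i = subtopology F (unit_tangent_over (D i) \<times> topspace (T i))"
    unfolding F_def subtopology_Times using subset by (simp add: subtopology_subtopology Int_absorb1)
  moreover have "openin F (unit_tangent_over (D i) \<times> topspace (T i))"
  proof -
    have "unit_tangent_over (D i) = unit_vectors \<inter> (D i \<times> UNIV)" using D_upper[OF i(1)] by (auto simp: unit_tangent_over_def)
    moreover have "open (D i \<times> (UNIV :: complex set))" by (intro open_Times open_D i open_UNIV)
    ultimately have "openin (top_of_set unit_vectors) (unit_tangent_over (D i))" by (metis openin_open_Int)
    then show ?thesis by (simp add: F_def openin_prod_Times_iff)
  qed
  ultimately have W: "openin F W" by (metis openin_trans_full)
  have "openin ?S {x \<in> topspace ?S. G x \<in> W}" by (rule openin_continuous_map_preimage[OF G W])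
  moreover have "(psl_frame h, (psl_frame k, t)) \<in> {x \<in> topspace ?S. G x \<in> W}"
  proof -
    have "G (psl_frame h, (psl_frame k, t)) = tangent_chart L i \<zeta>"
      by (simp add: G_def kt psl_frame_mult_eq_translate)
    then show ?thesis
      using tangent_chart_mem[OF i(1,2)] tangent_chart_mem[OF i(1,3)] tangent_point_chart[OF i(1,3)] V(2) psl_frame_unit
      by (simp add: W_def kt)
  qed
  ultimately obtain A B where AB: "openin (top_of_set unit_vectors) A" "openin (frame_box i) B" "psl_frame h \<in> A" "(psl_frame k, t) \<in> B"
      "A \<times> B \<subseteq> {x \<in> topspace ?S. G x \<in> W}"
    unfolding openin_prod_topology_alt by meson
  obtain e where e: "e > 0" "\<And>y. y \<in> unit_vectors \<Longrightarrow> dist y (psl_frame h) < e \<Longrightarrow> y \<in> A"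
    using AB(1,3) unfolding openin_euclidean_subtopology_iff by blast
  show ?thesis
  proof (rule that[OF _ _ e(1)])
    show "openin TM {\<xi> \<in> bundle_over i. tangent_chart L i \<xi> \<in> B}"
      by (rule open_tangent_chart_preimage[OF i(1) AB(2)])
    show "\<xi> \<in> {\<xi> \<in> bundle_over i. tangent_chart L i \<xi> \<in> B}" using i AB(4) by (simp add: kt)
    fix h' \<xi>' assume h': "dist (psl_frame h') (psl_frame h) < e" and "\<xi>' \<in> {\<xi> \<in> bundle_over i. tangent_chart L i \<xi> \<in> B}"
    then have \<xi>': "\<xi>' \<in> bundle_over i" "tangent_chart L i \<xi>' \<in> B" by auto
    obtain v t' where vt: "tangent_chart L i \<xi>' = (v, t')" by fastforce
    have "v \<in> unit_vectors" using tangent_chart_mem[OF i(1) \<xi>'(1)] subset by (auto simp: vt)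
    then obtain k' where k': "v = psl_frame k'" using psl_frame_surj by metis
    have "(psl_frame h', (v, t')) \<in> A \<times> B" using e(2)[OF psl_frame_unit h'] \<xi>'(2) vt by simp
    then have "G (psl_frame h', (v, t')) \<in> W" using AB(5) by blast
    then have mem: "(psl_frame (k' * h'), t') \<in> W" by (simp add: G_def k' psl_frame_mult_eq_translate)
    define \<zeta>' where "\<zeta>' = tangent_point i (psl_frame (k' * h'), t')"
    have "\<zeta>' \<in> V" "\<zeta>' \<in> bundle_over i" "tangent_chart L i \<zeta>' = (psl_frame (k' * h'), t')"
      using mem tangent_point_mem[OF i(1), of "(psl_frame (k' * h'), t')"] by (auto simp: W_def \<zeta>'_def)
    then show "\<exists>\<zeta>'\<in>V. chart_right_mult L \<xi>' h' \<zeta>'"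
      using \<xi>' i(1) vt k' unfolding chart_right_mult_def bundle_over_def by blast
  qed
qed

definition rotate_vector :: "complex \<Rightarrow> 'm \<times> ('i \<Rightarrow> complex) \<Rightarrow> 'm \<times> ('i \<Rightarrow> complex)" where
  "rotate_vector c \<xi> = (fst \<xi>, \<lambda>i. c * snd \<xi> i)"

lemma rotate_vector_mem:
  assumes "cmod c = 1" "\<xi> \<in> bundle" shows "rotate_vector c \<xi> \<in> bundle"
proof -
  have v: "snd \<xi> \<in> unit_tangent L (fst \<xi>)" using assms(2) by (simp add: mem_bundle)
  have "(\<lambda>i. c * snd \<xi> i) \<in> unit_tangent L (fst \<xi>)"
    unfolding unit_tangent_iff
  proof (intro conjI ballI allI impI)
    fix i assume "\<not> (i \<in> I \<and> fst \<xi> \<in> U i)"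
    then have "snd \<xi> i = 0" using v unfolding unit_tangent_iff by blast
    then show "c * snd \<xi> i = 0" by simp
  next
    fix i assume "i \<in> I" "fst \<xi> \<in> U i"
    then have "cmod (snd \<xi> i) = Im (fst (\<phi> i (fst \<xi>)))" using v unfolding unit_tangent_iff by blast
    then show "cmod (c * snd \<xi> i) = Im (fst (\<phi> i (fst \<xi>)))" using assms(1) by (simp add: norm_mult)
  next
    fix i j assume "i \<in> I" "j \<in> I" "fst \<xi> \<in> U i \<inter> U j"
    then have "snd \<xi> i = change_deriv i j (\<phi> j (fst \<xi>)) * snd \<xi> j" using v unfolding unit_tangent_iff by blast
    then show "c * snd \<xi> i = change_deriv i j (\<phi> j (fst \<xi>)) * (c * snd \<xi> j)" by simp
  qed
  then show ?thesis using assms(2) by (simp add: rotate_vector_def mem_bundle)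
qed

lemma tangent_chart_rotate:
  "tangent_chart L i (rotate_vector c \<xi>) = ((fst (fst (tangent_chart L i \<xi>)), c * snd (fst (tangent_chart L i \<xi>))), snd (tangent_chart L i \<xi>))"
  by (simp add: tangent_chart_def rotate_vector_def)

lemma chart_right_mult_rotation:
  assumes "\<xi> \<in> bundle"
  shows "chart_right_mult L \<xi> (rotation s) (rotate_vector (cayley s) \<xi>)"
proof -
  obtain i where i: "i \<in> I" "\<xi> \<in> bundle_over i" using bundle_over_cover[OF assms] by blast
  obtain z w t where zwt: "tangent_chart L i \<xi> = ((z, w), t)" by (metis prod.collapse)
  have "(z, w) \<in> unit_tangent_over (D i)" using tangent_chart_mem[OF i] by (simp add: zwt)
  then have "(z, w) \<in> unit_vectors" and Im: "Im z > 0" by (auto simp: unit_tangent_over_def upper_half_plane_def)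
  then obtain k where k: "psl_frame k = (z, w)" using psl_frame_surj by metis
  then have "psl_frame (k * rotation s) = (z, cayley s * w)"
    by (simp add: psl_frame_mult_eq_translate psl_frame_rotation frame_translate_rotation[OF Im])
  then show ?thesis
    using i assms rotate_vector_mem[OF cmod_cayley assms] zwt k
    unfolding chart_right_mult_def bundle_over_def
    by (intro conjI bexI[of _ i] exI[of _ k] exI[of _ t]) (simp_all add: tangent_chart_rotate, simp add: rotate_vector_def)
qed

lemma continuous_rotate:
  "continuous_map (prod_topology (top_of_set (sphere 0 1)) TM) TM (\<lambda>x. rotate_vector (fst x) (snd x))"
proof -
  let ?S = "top_of_set (sphere 0 1 :: complex set)"
  have "openin (prod_topology ?S TM) ((\<lambda>x. rotate_vector (fst x) (snd x)) -` {\<xi> \<in> bundle. fst \<xi> \<in> U i \<and> tangent_chart L i \<xi> \<in> W} \<inter> topspace (prod_topology ?S TM))"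
    if i: "i \<in> I" and W: "openin (frame_box i) W" for i W
  proof -
    let ?B = "subtopology TM (bundle_over i)"
    have tc: "continuous_map (prod_topology ?S ?B) (frame_box i) (\<lambda>x. tangent_chart L i (snd x))"
      using continuous_map_compose[OF continuous_map_snd continuous_tangent_chart[OF i]] by (simp add: o_def)
    have f: "continuous_map (prod_topology ?S ?B) euclidean (\<lambda>x. fst (tangent_chart L i (snd x)))"
      using continuous_map_compose[OF tc continuous_map_fst] continuous_map_into_fulltopology by (fastforce simp: o_def)
    have t: "continuous_map (prod_topology ?S ?B) (T i) (\<lambda>x. snd (tangent_chart L i (snd x)))"
      using continuous_map_compose[OF tc continuous_map_snd] by (simp add: o_def)
    have zw: "continuous_map (prod_topology ?S ?B) euclidean (\<lambda>x. fst (fst (tangent_chart L i (snd x))))"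
        "continuous_map (prod_topology ?S ?B) euclidean (\<lambda>x. snd (fst (tangent_chart L i (snd x))))"
      using f[folded prod_topology_euclidean] unfolding continuous_map_pairwise by (simp_all add: o_def)
    have c: "continuous_map (prod_topology ?S ?B) euclidean fst"
      using continuous_map_fst continuous_map_into_fulltopology by blast
    have "continuous_map (prod_topology ?S ?B) euclidean
       (\<lambda>x. (fst (fst (tangent_chart L i (snd x))), fst x * snd (fst (tangent_chart L i (snd x)))))"
      by (intro continuous_map_euclidean_pair continuous_map_complex_mult zw c)
    moreover have "(fst (fst (tangent_chart L i \<xi>)), c * snd (fst (tangent_chart L i \<xi>))) \<in> unit_tangent_over (D i)"
      if "cmod c = 1" "\<xi> \<in> bundle_over i" for c \<xi>
      using tangent_chart_mem[OF i that(2)] that(1) by (auto simp: mem_Times_iff unit_tangent_over_def norm_mult)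
    ultimately have "continuous_map (prod_topology ?S ?B) (top_of_set (unit_tangent_over (D i)))
       (\<lambda>x. (fst (fst (tangent_chart L i (snd x))), fst x * snd (fst (tangent_chart L i (snd x)))))"
      unfolding continuous_map_in_subtopology by (auto simp: topspace_bundle_over[OF i])
    then have "continuous_map (prod_topology ?S ?B) (frame_box i) (\<lambda>x. tangent_chart L i (rotate_vector (fst x) (snd x)))"
      unfolding tangent_chart_rotate by (intro continuous_map_pairedI t)
    from openin_continuous_map_preimage[OF this W]
    have "openin (prod_topology ?S ?B) {x \<in> topspace (prod_topology ?S ?B). tangent_chart L i (rotate_vector (fst x) (snd x)) \<in> W}" .
    moreover have "openin (prod_topology ?S TM) (topspace ?S \<times> bundle_over i)"
      using open_bundle_over[OF i] openin_topspace by (metis openin_prod_Times_iff)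
    ultimately have "openin (prod_topology ?S TM) {x \<in> topspace (prod_topology ?S ?B). tangent_chart L i (rotate_vector (fst x) (snd x)) \<in> W}"
      unfolding prod_topology_subtopology(2) by (rule openin_trans_full)
    moreover have "{x \<in> topspace (prod_topology ?S ?B). tangent_chart L i (rotate_vector (fst x) (snd x)) \<in> W}
      = (\<lambda>x. rotate_vector (fst x) (snd x)) -` {\<xi> \<in> bundle. fst \<xi> \<in> U i \<and> tangent_chart L i \<xi> \<in> W} \<inter> topspace (prod_topology ?S TM)"
      (is "?l = ?r")
    proof (intro set_eqI iffI)
      fix x assume x: "x \<in> ?l"
      then have "cmod (fst x) = 1" "snd x \<in> bundle_over i" "tangent_chart L i (rotate_vector (fst x) (snd x)) \<in> W"
        unfolding topspace_prod_topology topspace_bundle_over[OF i] by (auto simp: mem_Times_iff)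
      then show "x \<in> ?r"
        using rotate_vector_mem[of "fst x" "snd x"] by (simp add: topspace_TM bundle_over_def mem_Times_iff) (simp add: rotate_vector_def)
    next
      fix x assume "x \<in> ?r"
      then have "cmod (fst x) = 1" "snd x \<in> bundle" "fst (rotate_vector (fst x) (snd x)) \<in> U i" "tangent_chart L i (rotate_vector (fst x) (snd x)) \<in> W"
        by (auto simp: topspace_TM)
      then show "x \<in> ?l"
        unfolding topspace_prod_topology topspace_bundle_over[OF i]
        by (simp add: bundle_over_def mem_Times_iff) (simp add: rotate_vector_def)
    qed
    ultimately show ?thesis by simp
  qed
  moreover have "(\<lambda>x. rotate_vector (fst x) (snd x)) ` topspace (prod_topology ?S TM) \<subseteq> topspace TM"
    using rotate_vector_mem by (auto simp: topspace_TM)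
  ultimately show ?thesis
    unfolding tangent_topology_def
    by (intro continuous_on_generated_topo) (auto simp only: topology_generated_by_topspace)
qed

lemma right_action_step: "chart_right_mult L \<xi> h \<zeta> \<Longrightarrow> right_action L \<xi> h \<zeta>"
  using right_action.mult[OF right_action.one] by (fastforce simp: chart_right_mult_def)

lemma right_action_trans:
  assumes "right_action L \<eta> h \<zeta>" "right_action L \<xi> g \<eta>"
  shows "right_action L \<xi> (g * h) \<zeta>"
  using assms
proof (induction rule: right_action.induct)
  case (one \<eta>)
  then show ?case by simp
next
  case (mult \<eta> h \<zeta> h' \<zeta>')
  then show ?case using right_action.mult by (metis mult.assoc)
qed

lemma chart_right_mult_reverse:
  assumes "chart_right_mult L \<xi> g \<eta>" "g * g' = 1"
  shows "chart_right_mult L \<eta> g' \<xi>"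
proof -
  obtain i k t where "i \<in> I" "fst \<xi> \<in> U i" "fst \<eta> \<in> U i"
    and kt: "tangent_chart L i \<xi> = (psl_frame k, t)" "tangent_chart L i \<eta> = (psl_frame (k * g), t)"
    and "\<xi> \<in> bundle" "\<eta> \<in> bundle"
    using assms(1) unfolding chart_right_mult_def by blast
  moreover have "(k * g) * g' = k" using assms(2) by (simp add: mult.assoc)
  ultimately show ?thesis unfolding chart_right_mult_def by metis
qed

text \<open>
  Each step in a chart can be undone. Two chains of steps that start at the same vector can therefore be
  joined through that vector into one chain, to which the invariance of a set applies.
\<close>

lemma right_action_reverse:
  assumes "right_action L \<xi> g \<eta>" "g * g' = 1"
  shows "right_action L \<eta> g' \<xi>"
  using assms
proof (induction arbitrary: g' rule: right_action.induct)
  case (one \<xi>)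
  then show ?case using right_action.one by simp
next
  case (mult \<xi> g \<eta> h \<zeta>)
  obtain h' where h': "h * h' = 1" "h' * h = 1" using psl_right_inverse by blast
  obtain g'' where g'': "g * g'' = 1" "g'' * g = 1" using psl_right_inverse by blast
  have "right_action L \<zeta> (h' * g'') \<xi>"
    by (rule right_action_trans[OF mult.IH[OF g''(1)] right_action_step[OF chart_right_mult_reverse[OF mult.hyps(2) h'(1)]]])
  moreover have "h' * g'' = g'"
  proof -
    have "h' * g'' = h' * g'' * (g * h * g')" using mult.prems by simp
    also have "\<dots> = h' * (g'' * g) * h * g'" by (simp only: mult.assoc)
    also have "\<dots> = g'" using h' g'' by simp
    finally show ?thesis .
  qed
  ultimately show ?case by simp
qed

lemma right_action_mem: "right_action L \<xi> g \<eta> \<Longrightarrow> \<xi> \<in> bundle \<and> \<eta> \<in> bundle"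
  by (induction rule: right_action.induct) (auto simp: chart_right_mult_def)

lemma right_action_open:
  assumes "right_action L \<xi> g \<zeta>" "openin TM V" "\<zeta> \<in> V"
  shows "\<exists>N. openin TM N \<and> \<xi> \<in> N \<and> (\<forall>\<xi>'\<in>N. \<exists>\<zeta>'\<in>V. right_action L \<xi>' g \<zeta>')"
  using assms
proof (induction arbitrary: V rule: right_action.induct)
  case (one \<xi>)
  then show ?case
    using openin_subset[OF one(2)] right_action.one unfolding topspace_TM by blast
next
  case (mult \<xi> g \<eta> h \<zeta>)
  obtain N e where N: "openin TM N" "\<eta> \<in> N" "e > 0"
    "\<And>h' \<eta>'. dist (psl_frame h') (psl_frame h) < e \<Longrightarrow> \<eta>' \<in> N \<Longrightarrow> \<exists>\<zeta>'\<in>V. chart_right_mult L \<eta>' h' \<zeta>'"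
    using chart_right_mult_neighbourhood[OF mult.hyps(2) mult.prems] by metis
  obtain N' where N': "openin TM N'" "\<xi> \<in> N'" "\<forall>\<xi>'\<in>N'. \<exists>\<eta>'\<in>N. right_action L \<xi>' g \<eta>'"
    using mult.IH[OF N(1,2)] by blast
  have "\<exists>\<zeta>'\<in>V. right_action L \<xi>' (g * h) \<zeta>'" if "\<xi>' \<in> N'" for \<xi>'
  proof -
    obtain \<eta>' where "\<eta>' \<in> N" "right_action L \<xi>' g \<eta>'" using N'(3) \<open>\<xi>' \<in> N'\<close> by blast
    moreover obtain \<zeta>' where "\<zeta>' \<in> V" "chart_right_mult L \<eta>' h \<zeta>'" using N(4)[of h \<eta>'] N(3) \<open>\<eta>' \<in> N\<close> by auto
    ultimately show ?thesis using right_action.mult by blast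
  qed
  then show ?case using N' by blast
qed

section \<open>The fibres of an affine minimal set\<close>

text \<open>
  The points of \<open>X\<close> in the fibre of \<open>\<xi>\<close> other than \<open>\<xi>\<close>, in the affine coordinate on the boundary circle that
  puts \<open>\<xi>\<close> at infinity.
\<close>

definition fibre_coordinates :: "('m \<times> ('i \<Rightarrow> complex)) set \<Rightarrow> 'm \<times> ('i \<Rightarrow> complex) \<Rightarrow> real set" where
  "fibre_coordinates X \<xi> = {s. rotate_vector (cayley s) \<xi> \<in> X}"

text \<open>
  The path from \<open>\<eta>\<close> rotated by \<open>s\<close> back to \<open>\<eta>\<close>, on to \<open>\<xi>\<close>, and then to \<open>\<xi>\<close> rotated by the new parameter
  multiplies up to an element of the affine group, by \<open>rotation_affine_cocycle\<close>. Since \<open>X\<close> is invariant,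
  the end of the path is in \<open>X\<close> because its beginning is.
\<close>

lemma fibre_coordinates_affine:
  assumes X: "affine_invariant L X"
    and act: "right_action L \<xi> (affine_elt a b) \<eta>" and a: "a > 0" and s: "s \<in> fibre_coordinates X \<eta>"
  shows "a\<^sup>2 * s + a * b \<in> fibre_coordinates X \<xi>"
proof -
  let ?s' = "a\<^sup>2 * s + a * b"
  have \<xi>: "\<xi> \<in> bundle" and \<eta>: "\<eta> \<in> bundle" using right_action_mem[OF act] by auto
  obtain b' where b': "b' \<in> affine_subgroup" "rotation ?s' = affine_elt a b * rotation s * b'"
    using rotation_affine_cocycle[OF a refl] by blast
  obtain g where g: "(affine_elt a b * rotation s) * g = 1" "g * (affine_elt a b * rotation s) = 1"
    using psl_right_inverse by blast
  have "right_action L \<xi> (affine_elt a b * rotation s) (rotate_vector (cayley s) \<eta>)"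
    by (rule right_action_trans[OF right_action_step[OF chart_right_mult_rotation[OF \<eta>]] act])
  then have "right_action L (rotate_vector (cayley s) \<eta>) g \<xi>" using g(1) by (rule right_action_reverse)
  then have "right_action L (rotate_vector (cayley s) \<eta>) (g * rotation ?s') (rotate_vector (cayley ?s') \<xi>)"
    by (rule right_action_trans[OF right_action_step[OF chart_right_mult_rotation[OF \<xi>]]])
  moreover have "g * rotation ?s' = b'" unfolding b'(2) using g(2) by (metis mult.assoc mult_1)
  ultimately have "right_action L (rotate_vector (cayley s) \<eta>) b' (rotate_vector (cayley ?s') \<xi>)" by simp
  with X b'(1) s show ?thesis unfolding affine_invariant_def fibre_coordinates_def mem_Collect_eq by blast
qed

lemma continuous_rotate_cayley:
  "continuous_map (prod_topology (top_of_set S) TM) TM (\<lambda>x. rotate_vector (cayley (fst x)) (snd x))"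
proof -
  have "continuous_map (top_of_set S) (top_of_set (sphere 0 1)) cayley"
    using continuous_on_subset[OF continuous_on_cayley] by (auto simp: cmod_cayley)
  from continuous_map_compose[OF continuous_map_fst this]
  have "continuous_map (prod_topology (top_of_set S) TM) (prod_topology (top_of_set (sphere 0 1)) TM)
      (\<lambda>x. (cayley (fst x), snd x))"
    by (intro continuous_map_pairedI continuous_map_snd) (simp add: o_def)
  from continuous_map_compose[OF this continuous_rotate] show ?thesis by (simp add: o_def)
qed

lemma closed_fibre_coordinates:
  assumes "closedin TM X" "\<xi> \<in> bundle"
  shows "closed (fibre_coordinates X \<xi>)"
proof -
  have "continuous_map (top_of_set UNIV) (prod_topology (top_of_set UNIV) TM) (\<lambda>s::real. (s, \<xi>))"
    using assms(2) by (intro continuous_map_pairedI) (auto simp: topspace_TM)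
  from continuous_map_compose[OF this continuous_rotate_cayley]
  have "continuous_map euclideanreal TM (\<lambda>s. rotate_vector (cayley s) \<xi>)" by (simp add: o_def)
  from closedin_continuous_map_preimage[OF this assms(1)] show ?thesis
    by (simp add: fibre_coordinates_def)
qed

text \<open>
  The projection along the compact interval \<open>{-C..C}\<close> is a closed map.
\<close>

lemma closed_bounded_fibre_coordinate:
  assumes "closedin TM X"
  shows "closedin TM {\<xi> \<in> bundle. \<exists>s\<in>fibre_coordinates X \<xi>. \<bar>s\<bar> \<le> C}"
proof -
  let ?P = "prod_topology (top_of_set {-C..C}) TM"
  let ?Z = "{x \<in> topspace ?P. rotate_vector (cayley (fst x)) (snd x) \<in> X}"
  have "closedin ?P ?Z" by (rule closedin_continuous_map_preimage[OF continuous_rotate_cayley assms])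
  moreover have "closed_map ?P TM snd"
    by (rule Abstract_Topological_Spaces.closed_map_snd) (simp add: compact_space_subtopology)
  ultimately have "closedin TM (snd ` ?Z)" by (simp add: closed_map_def)
  moreover have "snd ` ?Z = {\<xi> \<in> bundle. \<exists>s\<in>fibre_coordinates X \<xi>. \<bar>s\<bar> \<le> C}"
  proof (intro set_eqI iffI)
    fix \<xi> assume "\<xi> \<in> snd ` ?Z"
    then obtain s where "s \<in> {-C..C}" "\<xi> \<in> bundle" "rotate_vector (cayley s) \<xi> \<in> X" by (auto simp: topspace_TM)
    then show "\<xi> \<in> {\<xi> \<in> bundle. \<exists>s\<in>fibre_coordinates X \<xi>. \<bar>s\<bar> \<le> C}"
      by (auto simp: fibre_coordinates_def abs_le_iff intro!: exI[of _ s])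
  next
    fix \<xi> assume "\<xi> \<in> {\<xi> \<in> bundle. \<exists>s\<in>fibre_coordinates X \<xi>. \<bar>s\<bar> \<le> C}"
    then obtain s where "\<xi> \<in> bundle" "rotate_vector (cayley s) \<xi> \<in> X" "\<bar>s\<bar> \<le> C" by (auto simp: fibre_coordinates_def)
    then show "\<xi> \<in> snd ` ?Z"
      by (intro image_eqI[of _ _ "(s, \<xi>)"]) (auto simp: topspace_TM)
  qed
  ultimately show ?thesis by simp
qed

lemma fibre_rotation:
  assumes \<xi>: "\<xi> \<in> bundle" and \<eta>: "\<eta> \<in> bundle" and "fst \<eta> = fst \<xi>" "\<eta> \<noteq> \<xi>"
  shows "\<exists>s. \<eta> = rotate_vector (cayley s) \<xi>"
proof -
  obtain i where i: "i \<in> I" "\<xi> \<in> bundle_over i" using bundle_over_cover[OF \<xi>] by blast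
  have x: "fst \<xi> \<in> U i" using i by (simp add: bundle_over_def)
  have v: "snd \<xi> \<in> unit_tangent L (fst \<xi>)" "snd \<eta> \<in> unit_tangent L (fst \<xi>)"
    using \<xi> \<eta> assms(3) by (auto simp: mem_bundle)
  have n: "cmod (snd \<xi> i) = Im (fst (\<phi> i (fst \<xi>)))" "cmod (snd \<eta> i) = Im (fst (\<phi> i (fst \<xi>)))"
    using v i(1) x unfolding unit_tangent_iff by blast+
  then have nz: "snd \<xi> i \<noteq> 0" using Im_chart_pos[OF i(1) x] by auto
  define c where "c = snd \<eta> i / snd \<xi> i"
  have c: "snd \<eta> i = c * snd \<xi> i" using nz by (simp add: c_def)
  have "cmod c = 1" using n nz by (metis c_def divide_self norm_divide norm_eq_zero)
  have \<eta>c: "\<eta> = rotate_vector c \<xi>"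
  proof (rule prod_eqI)
    show "fst \<eta> = fst (rotate_vector c \<xi>)" using assms(3) by (simp add: rotate_vector_def)
    have "snd \<eta> = tangent_vector i (fst \<xi>) (c * snd \<xi> i)"
      using unit_tangent_eq_tangent_vector[OF v(2) i(1) x] unfolding c .
    also have "\<dots> = (\<lambda>j. c * tangent_vector i (fst \<xi>) (snd \<xi> i) j)"
      by (auto simp: tangent_vector_def)
    also have "tangent_vector i (fst \<xi>) (snd \<xi> i) = snd \<xi>"
      using unit_tangent_eq_tangent_vector[OF v(1) i(1) x] by simp
    finally show "snd \<eta> = snd (rotate_vector c \<xi>)" by (simp add: rotate_vector_def)
  qed
  have "c \<noteq> 1"
  proof
    assume "c = 1"
    then have "\<eta> = \<xi>" unfolding \<eta>c by (simp add: rotate_vector_def)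
    with assms(4) show False ..
  qed
  with cayley_surj[OF \<open>cmod c = 1\<close>] \<eta>c show ?thesis by metis
qed

lemma open_affine_preimage:
  assumes "openin TM V"
  shows "openin TM {\<xi>. \<exists>\<eta>\<in>V. right_action L \<xi> b \<eta>}"
proof (subst openin_subopen, intro ballI)
  fix \<xi> assume "\<xi> \<in> {\<xi>. \<exists>\<eta>\<in>V. right_action L \<xi> b \<eta>}"
  then obtain \<eta> where "\<eta> \<in> V" "right_action L \<xi> b \<eta>" by blast
  with right_action_open[OF this(2) assms this(1)]
  show "\<exists>N. openin TM N \<and> \<xi> \<in> N \<and> N \<subseteq> {\<xi>. \<exists>\<eta>\<in>V. right_action L \<xi> b \<eta>}" by blast
qed

text \<open>
  The points of \<open>X\<close> that the affine group cannot carry into \<open>V\<close> form a closed invariant proper subset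
  of the minimal set, so there are none.
\<close>

lemma affine_minimal_set_orbit_meets:
  assumes X: "affine_minimal_set L X" and V: "openin TM V" "V \<inter> X \<noteq> {}" and \<xi>: "\<xi> \<in> X"
  shows "\<exists>b\<in>affine_subgroup. \<exists>\<eta>\<in>V. right_action L \<xi> b \<eta>"
proof (rule ccontr)
  assume no: "\<not> ?thesis"
  define R where "R = (\<Union>b\<in>affine_subgroup. {\<xi>. \<exists>\<eta>\<in>V. right_action L \<xi> b \<eta>})"
  have X': "closedin TM X" "affine_invariant L X"
    "\<And>Y. Y \<subseteq> X \<Longrightarrow> Y \<noteq> {} \<Longrightarrow> closedin TM Y \<Longrightarrow> affine_invariant L Y \<Longrightarrow> Y = X"
    using X unfolding affine_minimal_set_def by blast+
  have "openin TM R" unfolding R_def using open_affine_preimage[OF V(1)] by blast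
  then have closed: "closedin TM (X - R)" using X'(1) by (rule closedin_diff[rotated])
  have inv: "affine_invariant L (X - R)"
    unfolding affine_invariant_def
  proof (intro ballI allI impI)
    fix \<zeta> b \<eta> assume \<zeta>: "\<zeta> \<in> X - R" and b: "b \<in> affine_subgroup" and act: "right_action L \<zeta> b \<eta>"
    have "\<eta> \<in> X" using X'(2) \<zeta> b act unfolding affine_invariant_def by blast
    moreover have "\<eta> \<notin> R"
    proof
      assume "\<eta> \<in> R"
      then obtain b' \<theta> where "b' \<in> affine_subgroup" "\<theta> \<in> V" "right_action L \<eta> b' \<theta>" unfolding R_def by blast
      then have "b * b' \<in> affine_subgroup" "right_action L \<zeta> (b * b') \<theta>"
        using affine_subgroup_mult[OF b] right_action_trans[OF _ act] by auto
      then have "\<zeta> \<in> R" unfolding R_def using \<open>\<theta> \<in> V\<close> by blast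
      with \<zeta> show False by blast
    qed
    ultimately show "\<eta> \<in> X - R" by blast
  qed
  have "\<xi> \<in> X - R" using \<xi> no unfolding R_def by blast
  then have "X - R \<noteq> {}" by (metis empty_iff)
  then have "X - R = X" using closed inv by (rule X'(3)[OF Diff_subset])
  moreover obtain \<eta> where \<eta>: "\<eta> \<in> V" "\<eta> \<in> X" using V(2) by blast
  moreover have "\<eta> \<in> R"
  proof -
    have "\<eta> \<in> bundle" using openin_subset[OF V(1)] \<eta>(1) by (auto simp: topspace_TM)
    then have "right_action L \<eta> 1 \<eta>" by (rule right_action.one)
    then show ?thesis unfolding R_def using one_in_affine_subgroup \<eta>(1) by blast
  qed
  ultimately show False by blast
qed

text \<open>
  By compactness, all sufficiently small group elements act on all of \<open>X\<close> inside single charts. This is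
  completeness of the leaves in a form that suits an iteration of one small element.
\<close>

lemma uniform_chart_right_mult:
  assumes X: "compactin TM X"
  shows "\<exists>e>0. \<forall>h. dist (psl_frame h) (psl_frame 1) < e \<longrightarrow> (\<forall>\<xi>\<in>X. \<exists>\<zeta>. chart_right_mult L \<xi> h \<zeta>)"
proof -
  define good where "good N e \<longleftrightarrow> (\<forall>h \<xi>. dist (psl_frame h) (psl_frame 1) < e \<longrightarrow> \<xi> \<in> N \<longrightarrow> (\<exists>\<zeta>. chart_right_mult L \<xi> h \<zeta>))" for N e
  define \<N> where "\<N> = {N. openin TM N \<and> (\<exists>e>0. good N e)}"
  have "X \<subseteq> \<Union>\<N>"
  proof
    fix \<xi> assume "\<xi> \<in> X"
    then have \<xi>: "\<xi> \<in> topspace TM" using X by (auto dest: compactin_subset_topspace)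
    then have "chart_right_mult L \<xi> 1 \<xi>"
    proof -
      have b: "\<xi> \<in> bundle" using \<xi> by (simp add: topspace_TM)
      obtain i where i: "i \<in> I" "\<xi> \<in> bundle_over i" using bundle_over_cover[OF b] by blast
      obtain v t where vt: "tangent_chart L i \<xi> = (v, t)" by fastforce
      have "v \<in> unit_vectors" using tangent_chart_mem[OF i] by (auto simp: vt unit_tangent_over_def)
      then obtain k where k: "psl_frame k = v" using psl_frame_surj by blast
      then show ?thesis
        using i b vt unfolding chart_right_mult_def bundle_over_def by (metis (no_types, lifting) mem_Collect_eq mult_1_right)
    qed
    from chart_right_mult_neighbourhood[OF this openin_topspace \<xi>] obtain N e where N: "openin TM N" "\<xi> \<in> N" "e > 0"
      "\<And>h' \<xi>'. dist (psl_frame h') (psl_frame 1) < e \<Longrightarrow> \<xi>' \<in> N \<Longrightarrow> \<exists>\<zeta>'\<in>topspace TM. chart_right_mult L \<xi>' h' \<zeta>'"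
      by metis
    then have "good N e" unfolding good_def by blast
    then show "\<xi> \<in> \<Union>\<N>" using N unfolding \<N>_def by blast
  qed
  moreover have "\<forall>N\<in>\<N>. openin TM N" by (simp add: \<N>_def)
  ultimately obtain \<F> where F: "finite \<F>" "\<F> \<subseteq> \<N>" "X \<subseteq> \<Union>\<F>"
    using X unfolding compactin_def by meson
  have "\<forall>N\<in>\<F>. \<exists>e. e > 0 \<and> good N e" using F(2) by (auto simp: \<N>_def)
  from bchoice[OF this] obtain e where e: "\<And>N. N \<in> \<F> \<Longrightarrow> e N > 0 \<and> good N (e N)" by blast
  define d where "d = Min (insert 1 (e ` \<F>))"
  have "d > 0" unfolding d_def using F(1) e by (subst Min_gr_iff) auto
  moreover have "d \<le> e N" if "N \<in> \<F>" for N unfolding d_def using F(1) that by (intro Min_le) auto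
  ultimately have d: "d > 0" "\<And>N. N \<in> \<F> \<Longrightarrow> d \<le> e N" by blast+
  have "\<exists>\<zeta>. chart_right_mult L \<xi> h \<zeta>" if h: "dist (psl_frame h) (psl_frame 1) < d" and "\<xi> \<in> X" for h \<xi>
  proof -
    obtain N where N: "N \<in> \<F>" "\<xi> \<in> N" using F(3) \<open>\<xi> \<in> X\<close> by blast
    have "dist (psl_frame h) (psl_frame 1) < e N" using h d(2)[OF N(1)] by simp
    moreover have "good N (e N)" using e[OF N(1)] ..
    ultimately show ?thesis using N(2) unfolding good_def by blast
  qed
  with d(1) show ?thesis by blast
qed

text \<open>
  The sets \<open>F n\<close> of points with a coordinate in \<open>{-n..n}\<close> are closed and exhaust \<open>X\<close>, so by Baire one of
  them contains an open part of \<open>X\<close>. By minimality and compactness finitely many affine elements carry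
  every point of \<open>X\<close> into that part, and each of them distorts coordinates by one affine map.
\<close>

lemma bounded_fibre_coordinate:
  assumes X: "affine_minimal_set L X" "compactin TM X"
    and ne: "\<And>\<xi>. \<xi> \<in> X \<Longrightarrow> fibre_coordinates X \<xi> \<noteq> {}"
  shows "\<exists>C. \<forall>\<xi>\<in>X. \<exists>s\<in>fibre_coordinates X \<xi>. \<bar>s\<bar> \<le> C"
proof -
  have X': "X \<noteq> {}" "closedin TM X" "affine_invariant L X" using X(1) unfolding affine_minimal_set_def by blast+
  have sub: "X \<subseteq> bundle" using closedin_subset[OF X'(2)] by (simp add: topspace_TM)
  let ?TX = "subtopology TM X"
  define F where "F n = {\<xi> \<in> X. \<exists>s\<in>fibre_coordinates X \<xi>. \<bar>s\<bar> \<le> real n}" for n :: nat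
  have tX: "topspace ?TX = X" using sub by (auto simp: topspace_TM)
  have "\<exists>n. ?TX interior_of (F n) \<noteq> {}"
  proof (rule ccontr)
    assume "\<not> ?thesis"
    then have empty: "?TX interior_of (F n) = {}" for n by blast
    have closed: "closedin ?TX (F n)" for n
    proof -
      have "F n = X \<inter> {\<xi> \<in> bundle. \<exists>s\<in>fibre_coordinates X \<xi>. \<bar>s\<bar> \<le> real n}" using sub by (auto simp: F_def)
      then show ?thesis
        unfolding closedin_subtopology using closed_bounded_fibre_coordinate[OF X'(2), of "real n"] by (intro exI conjI) auto
    qed
    have "compact_space ?TX" using X(2) by (rule compact_space_subtopology)
    moreover have "Hausdorff_space ?TX" by (rule Hausdorff_space_subtopology[OF Hausdorff_TM])
    ultimately have "locally_compact_space ?TX \<and> regular_space ?TX"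
      by (simp add: compact_imp_locally_compact_space compact_Hausdorff_imp_regular_space)
    then have "?TX interior_of \<Union>(range F) = {}"
      by (intro Baire_category_alt) (auto simp: closed empty)
    moreover have "\<Union>(range F) = X"
    proof (intro subset_antisym subsetI)
      fix \<xi> assume \<xi>: "\<xi> \<in> X"
      then obtain s where "s \<in> fibre_coordinates X \<xi>" using ne by blast
      moreover obtain n where "\<bar>s\<bar> \<le> real n" using real_arch_simple by blast
      ultimately show "\<xi> \<in> \<Union>(range F)" using \<xi> by (auto simp: F_def)
    qed (auto simp: F_def)
    ultimately show False using X'(1) interior_of_topspace[of ?TX] tX by simp
  qed
  then obtain n \<xi>0 where "\<xi>0 \<in> ?TX interior_of (F n)" by blast
  then obtain W where "openin ?TX W" "\<xi>0 \<in> W" "W \<subseteq> F n" unfolding interior_of_def by blast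
  then obtain V where V: "openin TM V" "\<xi>0 \<in> V \<inter> X" "V \<inter> X \<subseteq> F n" by (auto simp: openin_subtopology)
  define \<N> where "\<N> = (\<lambda>b. {\<xi>. \<exists>\<eta>\<in>V. right_action L \<xi> b \<eta>})"
  have "X \<subseteq> \<Union>(\<N> ` affine_subgroup)"
    using affine_minimal_set_orbit_meets[OF X(1) V(1)] V(2) unfolding \<N>_def by blast
  moreover have "\<forall>N\<in>\<N> ` affine_subgroup. openin TM N" using open_affine_preimage[OF V(1)] by (auto simp: \<N>_def)
  ultimately obtain \<F> where "finite \<F>" "\<F> \<subseteq> \<N> ` affine_subgroup" "X \<subseteq> \<Union>\<F>"
    using X(2) unfolding compactin_def by meson
  then obtain B where B: "finite B" "B \<subseteq> affine_subgroup" "X \<subseteq> \<Union>(\<N> ` B)"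
    by (metis finite_subset_image)
  have "\<exists>c. \<forall>\<xi>\<in>X \<inter> \<N> b. \<exists>s\<in>fibre_coordinates X \<xi>. \<bar>s\<bar> \<le> c" if "b \<in> B" for b
  proof -
    have "b \<in> affine_subgroup" using \<open>b \<in> B\<close> B(2) by (rule rev_subsetD)
    then obtain a \<beta> where a: "a > 0" "b = affine_elt a \<beta>" unfolding affine_subgroup_iff by blast
    have "\<exists>s\<in>fibre_coordinates X \<xi>. \<bar>s\<bar> \<le> a\<^sup>2 * real n + \<bar>a * \<beta>\<bar>" if \<xi>: "\<xi> \<in> X \<inter> \<N> b" for \<xi>
    proof -
      obtain \<eta> where \<eta>: "\<eta> \<in> V" "right_action L \<xi> b \<eta>" using \<xi> by (auto simp: \<N>_def)
      have "\<eta> \<in> X" using X'(3) \<xi> \<eta>(2) \<open>b \<in> B\<close> B(2) unfolding affine_invariant_def by blast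
      then obtain s where s: "s \<in> fibre_coordinates X \<eta>" "\<bar>s\<bar> \<le> real n" using V(3) \<eta>(1) by (auto simp: F_def)
      have "a\<^sup>2 * s + a * \<beta> \<in> fibre_coordinates X \<xi>"
        using fibre_coordinates_affine[OF X'(3) _ a(1) s(1)] \<eta>(2) a(2) by simp
      moreover have "\<bar>a\<^sup>2 * s + a * \<beta>\<bar> \<le> a\<^sup>2 * real n + \<bar>a * \<beta>\<bar>"
      proof -
        have "\<bar>a\<^sup>2 * s + a * \<beta>\<bar> \<le> \<bar>a\<^sup>2 * s\<bar> + \<bar>a * \<beta>\<bar>" by (rule abs_triangle_ineq)
        also have "\<bar>a\<^sup>2 * s\<bar> \<le> a\<^sup>2 * real n" using s(2) by (simp add: abs_mult mult_left_mono)
        finally show ?thesis by simp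
      qed
      ultimately show ?thesis by blast
    qed
    then show ?thesis by blast
  qed
  then obtain c where c: "\<And>b \<xi>. b \<in> B \<Longrightarrow> \<xi> \<in> X \<inter> \<N> b \<Longrightarrow> \<exists>s\<in>fibre_coordinates X \<xi>. \<bar>s\<bar> \<le> c b" by metis
  have "\<exists>s\<in>fibre_coordinates X \<xi>. \<bar>s\<bar> \<le> Max (c ` B)" if \<xi>: "\<xi> \<in> X" for \<xi>
  proof -
    obtain b where b: "b \<in> B" "\<xi> \<in> \<N> b" using B(3) \<xi> by blast
    then obtain s where "s \<in> fibre_coordinates X \<xi>" "\<bar>s\<bar> \<le> c b" using c \<xi> by blast
    moreover have "c b \<le> Max (c ` B)" using B(1) b(1) by (intro Max_ge) auto
    ultimately show ?thesis by force
  qed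
  then show ?thesis by blast
qed

text \<open>
  The affine element used here acts on the coordinate as the contraction \<open>s \<mapsto> s0 + a\<^sup>2 * (s - s0)\<close>.
\<close>

lemma exists_contraction_near_one:
  assumes "e > 0"
  shows "\<exists>a. 0 < a \<and> a < 1 \<and> dist (psl_frame (affine_elt a (s0 * (1 - a\<^sup>2) / a))) (psl_frame 1) < e"
proof -
  let ?p = "\<lambda>a :: real. (of_real (a\<^sup>2) * \<i> + of_real (s0 * (1 - a\<^sup>2)), of_real (a\<^sup>2) * \<i>)"
  have "continuous (at_left 1) ?p" by (intro continuous_intros)
  then have "(?p \<longlongrightarrow> ?p 1) (at_left 1)" by (simp add: continuous_within)
  then have "\<forall>\<^sub>F a in at_left 1. dist (?p a) (\<i>, \<i>) < e" using assms by (auto dest: tendstoD)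
  moreover have "\<forall>\<^sub>F a in at_left (1::real). a \<in> {0<..<1}" by (rule eventually_at_left_real) simp
  ultimately have "\<forall>\<^sub>F a in at_left 1. dist (?p a) (\<i>, \<i>) < e \<and> a \<in> {0<..<1}" by (rule eventually_conj)
  then obtain a where a: "dist (?p a) (\<i>, \<i>) < e" "a \<in> {0<..<1}"
    using eventually_happens' trivial_limit_at_left_real by blast
  moreover have "psl_frame (affine_elt a (s0 * (1 - a\<^sup>2) / a)) = ?p a"
    using a(2) by (simp add: psl_frame_affine_elt)
  ultimately show ?thesis by (intro exI[of _ a]) (simp add: psl_frame_one)
qed

text \<open>
  A contraction of the line towards \<open>s0\<close> that acts on all of \<open>X\<close> improves the uniform bound for the
  distance from \<open>s0\<close> to the coordinates of \<open>X\<close> by a constant factor. Iterating it, the distance becomes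
  zero at every point of \<open>X\<close>, for every \<open>s0\<close>.
\<close>

lemma fibre_coordinates_UNIV:
  assumes X: "closedin TM X" "affine_invariant L X" "compactin TM X"
    and C: "\<And>\<xi>. \<xi> \<in> X \<Longrightarrow> \<exists>s\<in>fibre_coordinates X \<xi>. \<bar>s\<bar> \<le> C" and "\<xi> \<in> X"
  shows "fibre_coordinates X \<xi> = UNIV"
proof -
  have sub: "X \<subseteq> bundle" using closedin_subset[OF X(1)] by (simp add: topspace_TM)
  have "s0 \<in> fibre_coordinates X \<xi>" for s0
  proof -
    obtain e where e: "e > 0"
      "\<And>h \<xi>. dist (psl_frame h) (psl_frame 1) < e \<Longrightarrow> \<xi> \<in> X \<Longrightarrow> \<exists>\<zeta>. chart_right_mult L \<xi> h \<zeta>"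
      using uniform_chart_right_mult[OF X(3)] by blast
    obtain a where a: "0 < a" "a < 1" "dist (psl_frame (affine_elt a (s0 * (1 - a\<^sup>2) / a))) (psl_frame 1) < e"
      using exists_contraction_near_one[OF e(1)] by blast
    have close: "\<exists>s\<in>fibre_coordinates X \<xi>. \<bar>s - s0\<bar> \<le> (a\<^sup>2) ^ n * (C + \<bar>s0\<bar>)" if "\<xi> \<in> X" for n \<xi>
      using that
    proof (induction n arbitrary: \<xi>)
      case 0
      then obtain s where "s \<in> fibre_coordinates X \<xi>" "\<bar>s\<bar> \<le> C" using C by blast
      then show ?case by (intro bexI[of _ s]) auto
    next
      case (Suc n)
      let ?b = "affine_elt a (s0 * (1 - a\<^sup>2) / a)"
      obtain \<eta> where "chart_right_mult L \<xi> ?b \<eta>" using e(2)[OF a(3) Suc.prems] by blast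
      then have act: "right_action L \<xi> ?b \<eta>" by (rule right_action_step)
      moreover have "?b \<in> affine_subgroup" using a(1) by (auto simp: affine_subgroup_iff)
      ultimately have "\<eta> \<in> X" using X(2) Suc.prems unfolding affine_invariant_def by blast
      then obtain s where s: "s \<in> fibre_coordinates X \<eta>" "\<bar>s - s0\<bar> \<le> (a\<^sup>2) ^ n * (C + \<bar>s0\<bar>)" using Suc.IH by blast
      have "a\<^sup>2 * s + s0 * (1 - a\<^sup>2) \<in> fibre_coordinates X \<xi>"
        using fibre_coordinates_affine[OF X(2) act a(1) s(1)] a(1) by simp
      moreover have "\<bar>(a\<^sup>2 * s + s0 * (1 - a\<^sup>2)) - s0\<bar> \<le> (a\<^sup>2) ^ Suc n * (C + \<bar>s0\<bar>)"
      proof -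
        have "(a\<^sup>2 * s + s0 * (1 - a\<^sup>2)) - s0 = a\<^sup>2 * (s - s0)" by (simp add: algebra_simps)
        then have "\<bar>(a\<^sup>2 * s + s0 * (1 - a\<^sup>2)) - s0\<bar> = a\<^sup>2 * \<bar>s - s0\<bar>" by (simp add: abs_mult)
        also have "\<dots> \<le> a\<^sup>2 * ((a\<^sup>2) ^ n * (C + \<bar>s0\<bar>))" using s(2) by (intro mult_left_mono) auto
        finally show ?thesis by (simp add: mult.assoc)
      qed
      ultimately show ?case by blast
    qed
    have "a\<^sup>2 < 1" using a(1,2) by (simp add: power_less_one_iff)
    then have "(\<lambda>n. (a\<^sup>2) ^ n * (C + \<bar>s0\<bar>)) \<longlonglongrightarrow> 0 * (C + \<bar>s0\<bar>)"
      by (intro tendsto_mult tendsto_const LIMSEQ_realpow_zero) auto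
    then have lim: "(\<lambda>n. (a\<^sup>2) ^ n * (C + \<bar>s0\<bar>)) \<longlonglongrightarrow> 0" by simp
    have "\<exists>s\<in>fibre_coordinates X \<xi>. dist s s0 < d" if "d > 0" for d
    proof -
      have "\<forall>\<^sub>F n in sequentially. (a\<^sup>2) ^ n * (C + \<bar>s0\<bar>) < d" using order_tendstoD(2)[OF lim that] .
      then obtain n where "(a\<^sup>2) ^ n * (C + \<bar>s0\<bar>) < d" by (auto simp: eventually_sequentially)
      then show ?thesis using close[OF \<open>\<xi> \<in> X\<close>, of n] by (force simp: dist_real_def)
    qed
    then have "s0 \<in> closure (fibre_coordinates X \<xi>)" by (simp add: closure_approachable)
    moreover have "closed (fibre_coordinates X \<xi>)" using closed_fibre_coordinates X(1) \<open>\<xi> \<in> X\<close> sub by blast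
    ultimately show ?thesis by simp
  qed
  then show ?thesis by blast
qed

end

theorem proposition2:
  fixes L :: "('m, 'i, 't) lamination" and X :: "('m \<times> ('i \<Rightarrow> complex)) set"
  assumes "compact_hyperbolic_lamination L"
    and "minimal_lamination L"
    and "compactin (tangent_topology L) X"
    and "affine_minimal_set L X"
    and "\<forall>x\<in>topspace (lspace L).
           \<exists>\<xi>\<in>X \<inter> ({x} \<times> unit_tangent L x). \<exists>\<eta>\<in>X \<inter> ({x} \<times> unit_tangent L x). \<xi> \<noteq> \<eta>"
  shows "X = unit_tangent_bundle L"
proof -
  interpret hyperbolic_lamination L by unfold_locales (rule assms(1))
  have X: "closedin TM X" "affine_invariant L X" using assms(4) unfolding affine_minimal_set_def by blast+
  have sub: "X \<subseteq> bundle" using closedin_subset[OF X(1)] by (simp add: topspace_TM)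
  have ne: "fibre_coordinates X \<xi> \<noteq> {}" if "\<xi> \<in> X" for \<xi>
  proof -
    have "fst \<xi> \<in> topspace M" using that sub by (auto simp: mem_bundle)
    with assms(5) obtain \<eta>1 \<eta>2 where "\<eta>1 \<in> X" "fst \<eta>1 = fst \<xi>" "\<eta>2 \<in> X" "fst \<eta>2 = fst \<xi>" "\<eta>1 \<noteq> \<eta>2"
      by (metis IntE mem_Times_iff singletonD)
    then obtain \<eta> where \<eta>: "\<eta> \<in> X" "fst \<eta> = fst \<xi>" "\<eta> \<noteq> \<xi>" by metis
    then have "\<exists>s. \<eta> = rotate_vector (cayley s) \<xi>" using that sub by (intro fibre_rotation) auto
    with \<eta>(1) show ?thesis unfolding fibre_coordinates_def by blast
  qed
  obtain C where C: "\<And>\<xi>. \<xi> \<in> X \<Longrightarrow> \<exists>s\<in>fibre_coordinates X \<xi>. \<bar>s\<bar> \<le> C"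
    using bounded_fibre_coordinate[OF assms(4,3) ne] by blast
  have "\<eta> \<in> X" if \<eta>: "\<eta> \<in> bundle" for \<eta>
  proof -
    have "fst \<eta> \<in> topspace M" using \<eta> by (simp add: mem_bundle)
    with assms(5) obtain \<xi> where \<xi>: "\<xi> \<in> X" "fst \<xi> = fst \<eta>" by (metis IntE mem_Times_iff singletonD)
    show ?thesis
    proof (cases "\<eta> = \<xi>")
      case False
      then obtain s where "\<eta> = rotate_vector (cayley s) \<xi>" using fibre_rotation[of \<xi> \<eta>] \<xi> \<eta> sub by auto
      moreover have "s \<in> fibre_coordinates X \<xi>" using fibre_coordinates_UNIV[OF X assms(3) C \<xi>(1)] by simp
      ultimately show ?thesis by (simp add: fibre_coordinates_def)
    qed (use \<xi> in simp)
  qed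
  with sub show ?thesis by blast
qed

end
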